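(* Let $a,b\in\mathbb Z$ be such that $F(x)=x^7+ax+b$ is irreducible over $\mathbb Q$, and assume that for every prime integer $p$ one has $\nu_p(a)\le 5$ or $\nu_p(b)\le 6$. Let $\alpha$ be a root of $F(x)$, $K=\mathbb Q(\alpha)$ and $\mathbb Z_K$ its ring of integers. Then $\mathbb Z[\alpha]=\mathbb Z_K$ (i.e. $\mathbb Z[\alpha]$ is integrally closed) if and only if all of the following conditions hold: (1) For every prime integer $p$, if $p$ divides both $a$ and $b$, then $\nu_p(b)=1$. (2) If $2$ divides $b$ and $2$ does not divide $a$, then either ($a\equiv 3 \pmod 4$ and $b\equiv 2\pmod 4$) or ($a\equiv 1\pmod 4$ and $b\equiv 0\pmod 4$). (3) If $3$ divides $b$ and $a\equiv -1\pmod 3$, then $\nu_3(b+1+a)=\nu_3(b-1-a)=1$. (4) If $3$ divides $b$ and $a\equiv 1\pmod 3$, then $a\equiv 4\pmod 9$ or $a\equiv 7\pmod 9$ or $\nu_3(b)=1$. (5) If $7$ divides $a$ and $7$ does not divide $b$, then $\nu_7(1-a-b^6)=1$. (6) For every prime integer $p\notin\{2,3,7\}$, if $p$ does not divide both $a$ and $b$, then $\nu_p(7^7b^6+6^6a^7)\le 1$.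
   Context: For a prime $p$, $\nu_p$ denotes the $p$-adic valuation. *)

theory Defs
  imports
    Complex_Main
    "HOL-Computational_Algebra.Computational_Algebra"
    "HOL-Number_Theory.Cong"
    "HOL-Library.Extended_Nat"
begin

text \<open>The library's \<open>multiplicity p 0\<close> is \<open>0\<close>; the valuation of zero has to be infinite.\<close>

definition padic_val :: "int \<Rightarrow> int \<Rightarrow> enat" where
  "padic_val p n = (if n = 0 then \<infinity> else enat (multiplicity p n))"

definition is_subfield :: "'a::field set \<Rightarrow> bool" where
  "is_subfield S \<longleftrightarrow> 0 \<in> S \<and> 1 \<in> S
     \<and> (\<forall>x\<in>S. \<forall>y\<in>S. x + y \<in> S \<and> x * y \<in> S)
     \<and> (\<forall>x\<in>S. - x \<in> S \<and> inverse x \<in> S)"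

text \<open>Subfields of a field of characteristic zero contain the rationals,
  so generating by \<open>\<alpha>\<close> alone suffices.\<close>

definition rat_adjoin :: "'a::field_char_0 \<Rightarrow> 'a set" where
  "rat_adjoin \<alpha> = is_subfield hull {\<alpha>}"

definition int_adjoin :: "'a::field_char_0 \<Rightarrow> 'a set" where
  "int_adjoin \<alpha> = range (\<lambda>f :: int poly. poly (map_poly of_int f) \<alpha>)"

definition ring_of_integers :: "'a::field_char_0 set \<Rightarrow> 'a set" where
  "ring_of_integers K = {x \<in> K. algebraic_int x}"

end

theory Submission
  imports
    Defs
    "HOL-Computational_Algebra.Field_as_Ring"
    "Jordan_Normal_Form.Char_Poly"
begin

text \<open>
  This is Dedekind's criterion in ideal form: \<open>\<int>[\<alpha>]\<close> fails to be integrally closed iff \<open>F\<close> lies in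
  \<open>I\<^sup>2\<close> for some prime ideal \<open>I = (p, f)\<close> of \<open>\<int>[x]\<close>.

  If \<open>F = f\<^sup>2 g + p f u + p\<^sup>2 v\<close> with \<open>f\<close>, \<open>g\<close> monic, then \<open>\<theta> = f(\<alpha>) g(\<alpha>) / p\<close> satisfies
  \<open>\<theta>\<^sup>2 + u(\<alpha>) \<theta> + v(\<alpha>) g(\<alpha>) = 0\<close>, so it is an algebraic integer outside \<open>\<int>[\<alpha>]\<close>.
  Conversely, an integer of \<open>K\<close> outside \<open>\<int>[\<alpha>]\<close> has a multiple \<open>z \<notin> \<int>[\<alpha>]\<close> with \<open>p z \<in> \<int>[\<alpha>]\<close> whose
  annihilator modulo \<open>\<int>[\<alpha>]\<close> is a prime ideal \<open>(p, f)\<close>; clearing denominators in the integral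
  equation of \<open>z\<close> with \<open>p\<close> and with \<open>f(\<alpha>)\<close> forces \<open>F \<in> (p, f)\<^sup>2\<close>.

  For the trinomial, \<open>F \<in> I\<^sup>2\<close> gives \<open>F' \<in> I\<close>, hence \<open>6 a x + 7 b = 7 F - x F' \<in> I\<close>. For
  \<open>p\<close> not dividing \<open>6 a\<close> this determines the only possible double root \<open>c\<close>, and \<open>F \<in> I\<^sup>2\<close> becomes
  \<open>p\<^sup>2 dvd F(c)\<close>; for the other primes the factorisation of \<open>F\<close> modulo \<open>p\<close> is explicit.
\<close>

section \<open>Integer polynomials and algebraic integers\<close>

lemma monic_division:
  fixes f h :: "int poly"
  assumes "lead_coeff f = 1"
  obtains q r where "h = f * q + r" and "r = 0 \<or> degree r < degree f"
proof -
  obtain q r where qr: "pseudo_divmod h f = (q, r)" by force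
  have "f \<noteq> 0" using assms by auto
  from pseudo_divmod[OF this qr] assms show ?thesis by (intro that[of q r]) auto
qed

text \<open>Determinant trick: the \<open>v j\<close> form a nonzero eigenvector, with eigenvalue
  \<open>x\<close>, of the integer matrix \<open>A\<close>, and the characteristic polynomial of
  \<open>A\<close> is monic over \<int>.\<close>

lemma algebraic_int_if_int_combination:
  fixes v :: "nat \<Rightarrow> 'a :: field_char_0" and A :: "nat \<Rightarrow> nat \<Rightarrow> int"
  assumes nz: "k < n" "v k \<noteq> 0"
    and comb: "\<And>i. i < n \<Longrightarrow> x * v i = (\<Sum>j<n. of_int (A i j) * v j)"
  shows "algebraic_int x"
proof -
  define M where "M = mat n n (\<lambda>(i, j). A i j)"
  have M: "M \<in> carrier_mat n n" by (simp add: M_def)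
  define M' :: "'a mat" where "M' = map_mat of_int M"
  have M': "M' \<in> carrier_mat n n" using M by (simp add: M'_def)
  have "eigenvector M' (vec n v) x"
    unfolding eigenvector_def
  proof (intro conjI)
    show "vec n v \<in> carrier_vec (dim_row M')" using M' by simp
    show "vec n v \<noteq> 0\<^sub>v (dim_row M')"
    proof
      assume "vec n v = 0\<^sub>v (dim_row M')"
      hence "vec n v $ k = 0\<^sub>v (dim_row M') $ k" by simp
      with nz M' show False by simp
    qed
    show "M' *\<^sub>v vec n v = x \<cdot>\<^sub>v vec n v"
    proof (rule eq_vecI)
      fix i assume "i < dim_vec (x \<cdot>\<^sub>v vec n v)"
      hence i: "i < n" by simp
      have "(M' *\<^sub>v vec n v) $ i = (\<Sum>j<n. of_int (A i j) * v j)"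
        using i by (auto simp: M'_def M_def scalar_prod_def atLeast0LessThan intro!: sum.cong)
      thus "(M' *\<^sub>v vec n v) $ i = (x \<cdot>\<^sub>v vec n v) $ i"
        using comb[OF i] i by simp
    qed (use M' in simp)
  qed
  hence "eigenvalue M' x" by (auto simp: eigenvalue_def)
  hence "poly (char_poly M') x = 0" using eigenvalue_root_char_poly[OF M'] by simp
  moreover have "char_poly M' = map_poly of_int (char_poly M)"
    unfolding M'_def by (rule of_int_hom.char_poly_hom[OF M])
  ultimately show ?thesis
    using degree_monic_char_poly[OF M] unfolding algebraic_int_altdef_ipoly by auto
qed

lemma clear_denominators:
  fixes q :: "rat poly"
  obtains n :: int and k :: "int poly"
  where "n \<noteq> 0" and "[:of_int n:] * q = map_poly of_int k"
proof -
  have "\<exists>n k. n \<noteq> 0 \<and> [:of_int n:] * q = map_poly of_int k"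
  proof (induction q)
    case 0
    show ?case by (intro exI[of _ 1] exI[of _ 0]) simp
  next
    case (pCons c q)
    then obtain n k where nk: "n \<noteq> 0" "[:of_int n:] * q = map_poly of_int k" by blast
    obtain r s where rs: "quotient_of c = (r, s)" by force
    have s: "s > 0" and c: "c = of_int r / of_int s"
      using rs quotient_of_denom_pos quotient_of_div by auto
    have "[:of_int (s * n):] * q = [:of_int s:] * ([:of_int n:] * q)"
      by (simp add: mult.commute)
    also have "\<dots> = map_poly of_int ([:s:] * k)"
      by (simp add: nk(2) hom_distribs del: mult_pCons_left)
    finally have "[:of_int (s * n):] * pCons c q = map_poly of_int (pCons (n * r) ([:s:] * k))"
      using s c by (simp add: of_int_hom.map_poly_pCons_hom mult.commute)
    thus ?case using nk s by (intro exI[of _ "s * n"] exI[of _ "pCons (n * r) ([:s:] * k)"]) simp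
  qed
  thus ?thesis using that by blast
qed

text \<open>Modulo \<open>p\<close> this is scaling a nonzero polynomial to a monic one. A leading
  term divisible by \<open>p\<close> is moved into \<open>q\<close>, which lowers the degree for the
  induction.\<close>

lemma monic_multiple_mod_prime:
  fixes r :: "int poly" and p :: int
  assumes p: "prime p" and r: "\<not> [:p:] dvd r"
  obtains c q r' where "[:c:] * r = r' + [:p:] * q" "lead_coeff r' = 1" "degree r' \<le> degree r"
proof -
  have "\<exists>c q r'. [:c:] * r = r' + [:p:] * q \<and> lead_coeff r' = 1 \<and> degree r' \<le> degree r"
    using r
  proof (induction "degree r" arbitrary: r rule: less_induct)
    case less
    define n where "n = degree r"
    define l where "l = lead_coeff r"
    show ?case
    proof (cases "p dvd l")
      case False
      hence "coprime l p" using p prime_imp_coprime coprime_commute by blast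
      then obtain c where "[l * c = 1] (mod p)" using cong_solve_coprime_int by blast
      then obtain k where k: "c * l = 1 + p * k"
        by (metis cong_iff_lin cong_sym mult.commute)
      \<comment> \<open>Scaling by the inverse \<open>c\<close> of \<open>l\<close> modulo
        \<open>p\<close> makes the leading coefficient \<open>1 + p * k\<close>; the monomial
        corrects it to exactly 1.\<close>
      define r' where "r' = [:c:] * r - [:p:] * monom k n"
      have co: "coeff r' n = 1" using k by (simp add: r'_def l_def n_def)
      have le: "degree r' \<le> n" unfolding r'_def n_def
        by (intro degree_diff_le) (auto intro: order.trans[OF degree_smult_le] simp: degree_monom_le)
      have "degree r' = n" using co le by (metis le_degree le_antisym zero_neq_one)
      thus ?thesis using co
        by (intro exI[of _ c] exI[of _ "monom k n"] exI[of _ r']) (simp add: r'_def n_def)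
    next
      case True
      then obtain m where m: "l = p * m" by blast
      define s where "s = r - monom l n"
      have eq: "r = s + [:p:] * monom m n" by (simp add: s_def m smult_monom)
      have ns: "\<not> [:p:] dvd s"
      proof
        assume "[:p:] dvd s"
        hence "[:p:] dvd r" unfolding eq by (intro dvd_add dvd_triv_left)
        with less.prems show False by simp
      qed
      have n0: "n \<noteq> 0"
      proof
        assume "n = 0"
        hence "r = [:l:]" unfolding n_def l_def by (metis degree_0_id)
        hence "[:p:] dvd r" using m by simp
        with less.prems show False by simp
      qed
      have "degree s \<le> n" unfolding s_def n_def
        by (intro degree_diff_le) (auto simp: degree_monom_le)
      moreover have "coeff s n = 0" by (simp add: s_def l_def n_def)
      ultimately have deg: "degree s < n"
        using n0 by (metis coeff_eq_0 degree_0 gr0I leading_coeff_0_iff le_neq_implies_less)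
      from less.hyps[OF deg[unfolded n_def] ns] obtain c q r'
        where c: "[:c:] * s = r' + [:p:] * q" "lead_coeff r' = 1" "degree r' \<le> degree s" by blast
      have "[:c:] * r = r' + [:p:] * (q + [:c:] * monom m n)"
        unfolding eq distrib_left c(1) by (simp add: algebra_simps)
      thus ?thesis using c deg unfolding n_def by (meson less_imp_le order.trans)
    qed
  qed
  thus ?thesis using that by blast
qed

lemma is_subfield_rat_adjoin: "is_subfield (rat_adjoin \<alpha>)"
  unfolding rat_adjoin_def
  by (rule hull_in) (unfold is_subfield_def, blast)

lemma mem_rat_adjoin: "\<alpha> \<in> rat_adjoin \<alpha>"
  unfolding rat_adjoin_def by (rule hull_inc) simp

lemma rat_adjoin_of_int: "of_int n \<in> rat_adjoin \<alpha>"
proof -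
  have S: "0 \<in> rat_adjoin \<alpha>" "1 \<in> rat_adjoin \<alpha>"
    "\<And>x y. x \<in> rat_adjoin \<alpha> \<Longrightarrow> y \<in> rat_adjoin \<alpha> \<Longrightarrow> x + y \<in> rat_adjoin \<alpha>"
    "\<And>x. x \<in> rat_adjoin \<alpha> \<Longrightarrow> - x \<in> rat_adjoin \<alpha>"
    using is_subfield_rat_adjoin[of \<alpha>] unfolding is_subfield_def by blast+
  have nat: "of_nat m \<in> rat_adjoin \<alpha>" for m
    by (induction m) (auto intro: S)
  show ?thesis
    by (cases n rule: int_cases2) (auto intro: nat S)
qed

lemma int_adjoin_subset_rat_adjoin: "int_adjoin \<alpha> \<subseteq> rat_adjoin \<alpha>"
proof -
  have "poly (map_poly of_int f) \<alpha> \<in> rat_adjoin \<alpha>" for f :: "int poly"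
  proof (induction f)
    case 0
    show ?case using rat_adjoin_of_int[of 0] by simp
  next
    case (pCons c f)
    thus ?case using is_subfield_rat_adjoin[of \<alpha>] mem_rat_adjoin[of \<alpha>] rat_adjoin_of_int[of c \<alpha>]
      unfolding is_subfield_def by (simp add: map_poly_pCons)
  qed
  thus ?thesis by (auto simp: int_adjoin_def)
qed

section \<open>Prime ideals of the form (p, f)\<close>

text \<open>Primality of \<open>I\<close> stands in for irreducibility of \<open>f\<close> modulo
  \<open>p\<close>.\<close>

locale poly_prime_ideal =
  fixes p :: int and f :: "int poly" and I :: "int poly set"
  assumes prime_p: "prime p" and monic_f: "lead_coeff f = 1"
    and I_def: "I = {h. \<exists>u v. h = f * u + of_int p * v}"
    and proper: "1 \<notin> I"
    and prime_I: "s * t \<in> I \<Longrightarrow> s \<in> I \<or> t \<in> I"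
begin

lemma ideal_add: "s \<in> I \<Longrightarrow> t \<in> I \<Longrightarrow> s + t \<in> I"
proof -
  assume "s \<in> I" "t \<in> I"
  then obtain u v u' v' where "s = f * u + of_int p * v" "t = f * u' + of_int p * v'"
    unfolding I_def by blast
  hence "s + t = f * (u + u') + of_int p * (v + v')" by (simp add: algebra_simps)
  thus ?thesis unfolding I_def by blast
qed

lemma ideal_mult: "s \<in> I \<Longrightarrow> s * t \<in> I"
proof -
  assume "s \<in> I"
  then obtain u v where "s = f * u + of_int p * v" unfolding I_def by blast
  hence "s * t = f * (u * t) + of_int p * (v * t)" by (simp add: algebra_simps)
  thus ?thesis unfolding I_def by blast
qed

lemma ideal_mult': "s \<in> I \<Longrightarrow> t * s \<in> I"
  using ideal_mult[of s t] by (simp add: mult.commute)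

lemma ideal_minus: "s \<in> I \<Longrightarrow> - s \<in> I"
  using ideal_mult[of s "-1"] by simp

lemma ideal_diff: "s \<in> I \<Longrightarrow> t \<in> I \<Longrightarrow> s - t \<in> I"
  using ideal_add[of s "- t"] ideal_minus by simp

lemma f_in_ideal: "f \<in> I"
  unfolding I_def by (rule CollectI, rule exI[of _ 1], rule exI[of _ 0]) simp

lemma p_in_ideal: "of_int p \<in> I"
  unfolding I_def by (rule CollectI, rule exI[of _ 0], rule exI[of _ 1]) simp

lemma prime_power: "s ^ n \<in> I \<Longrightarrow> s \<in> I"
  by (induction n) (use proper prime_I in auto)

lemma prime_elem_p: "prime_elem (of_int p :: int poly)"
  unfolding of_int_poly of_int_eq_id id_apply by (rule lift_prime_elem_poly) (use prime_p in blast)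

lemma p_not_dvd_f: "\<not> of_int p dvd f"
proof
  assume "of_int p dvd f"
  then obtain g where g: "f = of_int p * g" by blast
  have "lead_coeff f = p * coeff g (degree f)" by (subst g, simp add: of_int_poly)
  hence "p dvd 1" using monic_f by (metis dvd_triv_left)
  thus False using prime_p not_prime_unit by blast
qed

lemma of_int_mem_iff: "of_int n \<in> I \<longleftrightarrow> p dvd n"
proof
  assume n: "of_int n \<in> I"
  show "p dvd n"
  proof (rule ccontr)
    assume "\<not> p dvd n"
    hence "coprime p n" using prime_p by (simp add: prime_imp_coprime)
    then obtain r s where "r * p + s * n = 1" by (metis bezout_int coprime_iff_gcd_eq_1)
    hence "(1 :: int poly) = of_int (r * p + s * n)" by simp
    also have "\<dots> = of_int r * of_int p + of_int s * of_int n" by simp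
    also have "\<dots> \<in> I" by (intro ideal_add ideal_mult' n p_in_ideal)
    finally show False using proper by simp
  qed
next
  assume "p dvd n"
  thus "of_int n \<in> I" using p_in_ideal ideal_mult by (auto elim!: dvdE)
qed

lemma of_int_mult_mem_iff: "of_int n * s \<in> I \<longleftrightarrow> p dvd n \<or> s \<in> I"
  using prime_I[of "of_int n" s] of_int_mem_iff ideal_mult ideal_mult' by blast

text \<open>This is the square of the ideal \<open>I\<close>, spelled out on the products of its two
  generators.\<close>

definition I2 :: "int poly set" where
  "I2 = {h. \<exists>g u v. h = f ^ 2 * g + of_int p * f * u + of_int p ^ 2 * v}"

lemma ideal2_diff: "s \<in> I2 \<Longrightarrow> t \<in> I2 \<Longrightarrow> s - t \<in> I2"
proof -
  assume "s \<in> I2" "t \<in> I2"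
  then obtain g u v g' u' v' where "s = f ^ 2 * g + of_int p * f * u + of_int p ^ 2 * v"
      "t = f ^ 2 * g' + of_int p * f * u' + of_int p ^ 2 * v'"
    unfolding I2_def by blast
  hence "s - t = f ^ 2 * (g - g') + of_int p * f * (u - u') + of_int p ^ 2 * (v - v')"
    by (simp add: algebra_simps)
  thus ?thesis unfolding I2_def by blast
qed

lemma mult_mem_ideal2: "s \<in> I \<Longrightarrow> t \<in> I \<Longrightarrow> s * t \<in> I2"
proof -
  assume "s \<in> I" "t \<in> I"
  then obtain u v u' v' where "s = f * u + of_int p * v" "t = f * u' + of_int p * v'"
    unfolding I_def by blast
  hence "s * t = f ^ 2 * (u * u') + of_int p * f * (u * v' + u' * v) + of_int p ^ 2 * (v * v')"
    by (simp add: algebra_simps power2_eq_square)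
  thus ?thesis unfolding I2_def by blast
qed

text \<open>In such a representation \<open>p\<close> divides \<open>f ^ 2 * g\<close>. As
  \<open>p\<close> is a prime element of \<int>[x] and does not divide the monic \<open>f\<close>,
  it divides \<open>g\<close>, and one factor \<open>p\<close> cancels.\<close>

lemma ideal2_cancel_p:
  assumes "of_int p * s \<in> I2"
  shows "s \<in> I"
proof -
  obtain g u v where eq: "of_int p * s = f ^ 2 * g + of_int p * f * u + of_int p ^ 2 * v"
    using assms unfolding I2_def by blast
  have "f ^ 2 * g = of_int p * (s - f * u - of_int p * v)"
    using eq by (simp add: algebra_simps power2_eq_square)
  hence "of_int p dvd f * (f * g)" by (simp add: power2_eq_square mult.assoc)
  hence "of_int p dvd g"
    using prime_elem_p p_not_dvd_f prime_elem_dvd_multD by metis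
  then obtain g' where "g = of_int p * g'" by blast
  hence "of_int p * s = of_int p * (f * (f * g' + u) + of_int p * v)"
    using eq by (simp add: algebra_simps power2_eq_square)
  hence "s = f * (f * g' + u) + of_int p * v"
    using prime_p by auto
  thus ?thesis unfolding I_def by blast
qed

lemma of_int_mem_ideal2:
  assumes "of_int n \<in> I2" "p dvd n"
  shows "p ^ 2 dvd n"
proof -
  obtain m where m: "n = p * m" using assms by blast
  hence "of_int m \<in> I" using assms(1) by (intro ideal2_cancel_p) simp
  thus ?thesis by (simp add: of_int_mem_iff m power2_eq_square)
qed

lemma ideal2_subset: "s \<in> I2 \<Longrightarrow> s \<in> I"
proof -
  assume "s \<in> I2"
  then obtain g u v where "s = f ^ 2 * g + of_int p * f * u + of_int p ^ 2 * v"
    unfolding I2_def by blast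
  hence "s = f * (f * g + of_int p * u) + of_int p * (of_int p * v)"
    by (simp add: algebra_simps power2_eq_square)
  thus ?thesis unfolding I_def by blast
qed

text \<open>By the product rule, differentiating a product of two elements of \<open>I\<close>
  leaves one of them as a factor in each term.\<close>

lemma pderiv_mem:
  assumes "s \<in> I2"
  shows "pderiv s \<in> I"
proof -
  obtain g u v where s: "s = f ^ 2 * g + of_int p * f * u + of_int p ^ 2 * v"
    using assms unfolding I2_def by blast
  have "pderiv s = f * (2 * pderiv f * g + f * pderiv g)
      + of_int p * (f * pderiv u + pderiv f * u + of_int p * pderiv v)"
    unfolding s by (simp add: pderiv_add pderiv_mult pderiv_smult smult_add_right power2_eq_square of_int_poly algebra_simps)
  thus ?thesis unfolding I_def by blast
qed

end

section \<open>Dedekind's criterion\<close>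

locale monogenic_field =
  fixes F :: "int poly" and \<alpha> :: "'a :: field_char_0"
  assumes monic: "lead_coeff F = 1"
    and irred: "irreducible (map_poly rat_of_int F)"
    and root: "poly (map_poly of_int F) \<alpha> = 0"
begin

section \<open>Evaluation of integer polynomials at the root\<close>

abbreviation ev :: "int poly \<Rightarrow> 'a" where
  "ev h \<equiv> poly (map_poly of_int h) \<alpha>"

lemma ev_hom:
  "ev (g + h) = ev g + ev h" "ev (g - h) = ev g - ev h" "ev (- h) = - ev h"
  "ev (g * h) = ev g * ev h" "ev (h ^ n) = ev h ^ n" "ev 0 = 0" "ev 1 = 1" "ev (of_int c) = of_int c"
  "ev (\<Sum>i\<in>A. H i) = (\<Sum>i\<in>A. ev (H i))"
  by (simp_all add: hom_distribs poly_sum of_int_poly map_poly_pCons)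

lemma ev_in_int_adjoin [simp]: "ev h \<in> int_adjoin \<alpha>"
  by (auto simp: int_adjoin_def)

lemma int_adjoinE:
  assumes "x \<in> int_adjoin \<alpha>"
  obtains h where "x = ev h"
  using assms by (auto simp: int_adjoin_def)

lemma ev_eq_poly_of_rat:
  "ev h = poly (map_poly of_rat (map_poly rat_of_int h)) \<alpha>"
  by (simp add: map_poly_map_poly o_def)

text \<open>Bezout over the rationals: \<open>F\<close> is irreducible, hence coprime to
  \<open>h\<close>, and evaluation at \<alpha> kills the multiple of \<open>F\<close>.\<close>

lemma inverse_if_not_dvd:
  assumes "\<not> map_poly rat_of_int F dvd map_poly rat_of_int h"
  obtains t :: "rat poly" where "poly (map_poly of_rat t) \<alpha> * ev h = 1"
proof -
  interpret of_rat_poly: map_poly_comm_ring_hom "of_rat :: rat \<Rightarrow> 'a" ..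
  let ?F = "map_poly rat_of_int F" and ?h = "map_poly rat_of_int h"
  have "coprime ?F ?h"
    by (rule prime_elem_imp_coprime[OF field_poly_irreducible_imp_prime[OF irred] assms])
  hence gcd: "gcd ?F ?h = 1" by (rule coprime_imp_gcd_eq_1)
  obtain s t where st: "s * ?F + t * ?h = 1"
    using bezout_coefficients_fst_snd[of ?F ?h] unfolding gcd by blast
  have "poly (map_poly of_rat (s * ?F + t * ?h)) \<alpha> = poly (map_poly of_rat t) \<alpha> * ev h"
    unfolding of_rat_poly.hom_add of_rat_poly.hom_mult ev_eq_poly_of_rat
    using root by (simp flip: ev_eq_poly_of_rat)
  thus ?thesis using that[of t] by (simp add: st)
qed

text \<open>Dividing by the monic \<open>F\<close> stays inside \<int>[x]. The remainder vanishes at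
  \<alpha>, so it is a rational multiple of \<open>F\<close> of too small a degree, that is,
  zero.\<close>

lemma ev_eq_0_iff: "ev h = 0 \<longleftrightarrow> F dvd h"
proof
  assume h: "ev h = 0"
  obtain q r where qr: "h = F * q + r" "r = 0 \<or> degree r < degree F"
    using monic_division[OF monic] by blast
  have "ev r = 0" using h root by (simp add: qr(1) ev_hom)
  hence "map_poly rat_of_int F dvd map_poly rat_of_int r"
    using inverse_if_not_dvd[of r] by auto
  hence "r = 0"
    using qr(2) by (auto dest!: dvd_imp_degree_le)
  thus "F dvd h" by (simp add: qr(1))
qed (auto simp: ev_hom root)

lemma ev_eq_iff: "ev g = ev h \<longleftrightarrow> F dvd g - h"
  using ev_eq_0_iff[of "g - h"] by (simp add: ev_hom)

lemma degree_F_pos: "degree F > 0"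
proof (rule ccontr)
  assume "\<not> ?thesis"
  hence "F = 1" using monic by (metis degree_0_id gr0I one_pCons)
  thus False using root by simp
qed

lemma ev_eq_sum:
  obtains c :: "nat \<Rightarrow> int" where "ev h = (\<Sum>i<degree F. of_int (c i) * \<alpha> ^ i)"
proof -
  obtain q r where qr: "h = F * q + r" "r = 0 \<or> degree r < degree F"
    using monic_division[OF monic] by blast
  have "ev h = ev r" by (simp add: qr(1) ev_hom root)
  also have "\<dots> = (\<Sum>i\<le>degree F - 1. of_int (coeff r i) * \<alpha> ^ i)"
    by (subst poly_as_sum_of_monoms'[of "map_poly of_int r" "degree F - 1", symmetric])
       (use qr(2) degree_F_pos in \<open>auto simp: poly_sum poly_monom\<close>)
  also have "{..degree F - 1} = {..<degree F}"
    using degree_F_pos by auto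
  finally show ?thesis by (rule that)
qed

text \<open>The powers of \<alpha> below \<open>degree F\<close>, together with their products with
  \<theta>, span over \<int> a module that \<theta> maps into itself. The family \<open>v\<close>
  lists these two blocks one after the other.\<close>

lemma algebraic_int_if_quadratic:
  assumes eq: "\<theta> ^ 2 = ev u * \<theta> + ev w"
  shows "algebraic_int \<theta>"
proof -
  define d where "d = degree F"
  define v where "v i = (if i < d then \<alpha> ^ i else \<alpha> ^ (i - d) * \<theta>)" for i
  have comb: "\<exists>c. ev s + ev t * \<theta> = (\<Sum>j<2*d. of_int (c j) * v j)" for s t
  proof -
    obtain a where a: "ev s = (\<Sum>i<d. of_int (a i) * \<alpha> ^ i)" using ev_eq_sum unfolding d_def by blast
    obtain b where b: "ev t = (\<Sum>i<d. of_int (b i) * \<alpha> ^ i)" using ev_eq_sum unfolding d_def by blast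
    define c where "c i = (if i < d then a i else b (i - d))" for i
    have "(\<Sum>j<2*d. of_int (c j) * v j) =
        (\<Sum>j<d. of_int (c j) * v j) + (\<Sum>j<d. of_int (c (j + d)) * v (j + d))"
      using sum.nat_group[of "\<lambda>j. of_int (c j) * v j" d 2]
        sum.shift_bounds_nat_ivl[of "\<lambda>j. of_int (c j) * v j" 0 d d]
      by (simp add: numeral_2_eq_2 lessThan_atLeast0)
    also have "(\<Sum>j<d. of_int (c j) * v j) = ev s"
      by (simp add: a c_def v_def)
    also have "(\<Sum>j<d. of_int (c (j + d)) * v (j + d)) = ev t * \<theta>"
      by (simp add: b c_def v_def sum_distrib_right mult.assoc)
    finally show ?thesis by metis
  qed
  have "\<exists>c. \<theta> * v i = (\<Sum>j<2*d. of_int (c j) * v j)" for i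
  proof (cases "i < d")
    case True
    thus ?thesis using comb[of 0 "monom 1 i"] by (simp add: v_def poly_monom mult.commute)
  next
    case False
    have "\<theta> * v i = \<alpha> ^ (i - d) * \<theta> ^ 2" using False by (simp add: v_def power2_eq_square)
    also have "\<dots> = ev (monom 1 (i - d) * w) + ev (monom 1 (i - d) * u) * \<theta>"
      unfolding eq by (simp add: ev_hom poly_monom algebra_simps)
    finally show ?thesis using comb by metis
  qed
  then obtain A where "\<And>i. \<theta> * v i = (\<Sum>j<2*d. of_int (A i j) * v j)" by metis
  moreover have "0 < 2 * d" "v 0 \<noteq> 0" using degree_F_pos by (auto simp: v_def d_def)
  ultimately show ?thesis by (rule algebraic_int_if_int_combination[of 0 "2 * d" v, rotated 2])
qed

lemma int_adjoin_subset_integers: "int_adjoin \<alpha> \<subseteq> ring_of_integers (rat_adjoin \<alpha>)"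
proof
  fix x assume x: "x \<in> int_adjoin \<alpha>"
  then obtain h where h: "x = ev h" by (rule int_adjoinE)
  have "algebraic_int x"
    by (rule algebraic_int_if_quadratic[of _ h 0]) (simp add: h power2_eq_square)
  thus "x \<in> ring_of_integers (rat_adjoin \<alpha>)"
    using x int_adjoin_subset_rat_adjoin by (auto simp: ring_of_integers_def)
qed

theorem not_integrally_closed_if_square_ideal:
  assumes p: "prime p" and fg: "lead_coeff f = 1" "lead_coeff g = 1" "degree (f * g) < degree F"
    and F: "F = f ^ 2 * g + of_int p * f * u + of_int p ^ 2 * v"
  shows "int_adjoin \<alpha> \<noteq> ring_of_integers (rat_adjoin \<alpha>)"
proof
  assume eq: "int_adjoin \<alpha> = ring_of_integers (rat_adjoin \<alpha>)"
  define \<theta> where "\<theta> = ev (f * g) / of_int p"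
  have p0: "(of_int p :: 'a) \<noteq> 0" using p by auto
  have "ev F = 0" by (rule root)
  hence "ev f ^ 2 * ev g + of_int p * ev f * ev u + of_int p ^ 2 * ev v = 0"
    by (subst (asm) F) (simp add: ev_hom)
  moreover have "of_int p ^ 2 * (\<theta> ^ 2 + ev u * \<theta> + ev v * ev g) =
      (ev f ^ 2 * ev g + of_int p * ev f * ev u + of_int p ^ 2 * ev v) * ev g"
    using p0 by (simp add: \<theta>_def ev_hom field_simps power2_eq_square)
  ultimately have "\<theta> ^ 2 + ev u * \<theta> + ev v * ev g = 0"
    using p0 by simp
  hence "\<theta> ^ 2 = ev (- u) * \<theta> + ev (- (v * g))"
    by (simp add: ev_hom algebra_simps eq_neg_iff_add_eq_0)
  hence "algebraic_int \<theta>" by (rule algebraic_int_if_quadratic)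
  moreover have "\<theta> \<in> rat_adjoin \<alpha>"
    using is_subfield_rat_adjoin[of \<alpha>] rat_adjoin_of_int[of p \<alpha>]
      int_adjoin_subset_rat_adjoin[of \<alpha>] ev_in_int_adjoin[of "f * g"]
    unfolding \<theta>_def is_subfield_def divide_inverse by blast
  ultimately have "\<theta> \<in> int_adjoin \<alpha>" using eq by (simp add: ring_of_integers_def)
  then obtain h where h: "\<theta> = ev h" by (rule int_adjoinE)
  obtain q r where qr: "h = F * q + r" "r = 0 \<or> degree r < degree F"
    using monic_division[OF monic] by blast
  have "ev (f * g) = ev (of_int p * r)"
    using h p0 by (simp add: \<theta>_def qr(1) ev_hom root field_simps)
  hence "F dvd f * g - of_int p * r" by (simp add: ev_eq_iff)
  \<comment> \<open>Below the degree of \<open>F\<close>, divisibility by \<open>F\<close> means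
    vanishing; the monic \<open>f * g\<close> would then be a multiple of \<open>p\<close>.\<close>
  moreover have "degree (f * g - of_int p * r) < degree F"
    using fg(3) qr(2) degree_F_pos
    by (intro degree_diff_less) (auto simp: of_int_poly intro: le_less_trans[OF degree_smult_le])
  ultimately have "f * g = of_int p * r"
    by (metis dvd_imp_degree_le leD eq_iff_diff_eq_0)
  hence "lead_coeff (f * g) = p * coeff r (degree (f * g))"
    by (simp add: of_int_poly)
  hence "p dvd 1" using fg(1,2) by (metis dvd_triv_left lead_coeff_mult mult_1)
  thus False using p not_prime_unit by blast
qed

section \<open>Denominators of field elements and integrality over \<int>[\<alpha>]\<close>

lemma rat_adjoin_denominator:
  assumes "x \<in> rat_adjoin \<alpha>"
  obtains N :: int and h where "N \<noteq> 0" "of_int N * x = ev h"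
proof -
  \<comment> \<open>The elements with a nonzero integer multiple in \<int>[\<alpha>] form a subfield
    containing \<alpha>, so they contain the hull.\<close>
  define S where "S = {x. \<exists>N h. N \<noteq> 0 \<and> of_int N * x = ev h}"
  have SI: "x \<in> S" if "N \<noteq> 0" "of_int N * x = ev h" for x N h
    using that unfolding S_def by blast
  have add: "x + y \<in> S" and mult: "x * y \<in> S" if "x \<in> S" "y \<in> S" for x y
  proof -
    from that obtain N h M k where *: "N \<noteq> 0" "of_int N * x = ev h" "M \<noteq> 0" "of_int M * y = ev k"
      unfolding S_def by blast
    have "of_int (N * M) * (x + y) = of_int M * (of_int N * x) + of_int N * (of_int M * y)"
      by (simp add: algebra_simps)
    also have "\<dots> = ev (of_int M * h + of_int N * k)" by (simp add: * ev_hom)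
    finally show "x + y \<in> S" using * by (intro SI[of "N * M"]) auto
    have "of_int (N * M) * (x * y) = (of_int N * x) * (of_int M * y)"
      by (simp add: algebra_simps)
    also have "\<dots> = ev (h * k)" by (simp add: * ev_hom)
    finally show "x * y \<in> S" using * by (intro SI[of "N * M"]) auto
  qed
  have minus: "- x \<in> S" if "x \<in> S" for x
  proof -
    from that obtain N h where *: "N \<noteq> 0" "of_int N * x = ev h" unfolding S_def by blast
    thus ?thesis by (intro SI[of N _ "- h"]) (auto simp: ev_hom)
  qed
  have inverse: "inverse x \<in> S" if "x \<in> S" for x
  proof (cases "x = 0")
    case False
    from that obtain N h where *: "N \<noteq> 0" "of_int N * x = ev h" unfolding S_def by blast
    have "ev h \<noteq> 0" using * False by (metis mult_eq_0_iff of_int_eq_0_iff)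
    have "\<not> map_poly rat_of_int F dvd map_poly rat_of_int h"
    proof
      interpret of_rat_poly: map_poly_comm_ring_hom "of_rat :: rat \<Rightarrow> 'a" ..
      assume "map_poly rat_of_int F dvd map_poly rat_of_int h"
      then obtain s where "map_poly rat_of_int h = map_poly rat_of_int F * s" by blast
      hence "ev h = ev F * poly (map_poly of_rat s) \<alpha>"
        unfolding ev_eq_poly_of_rat by (simp add: of_rat_poly.hom_mult)
      thus False using root \<open>ev h \<noteq> 0\<close> by simp
    qed
    then obtain t where t: "poly (map_poly of_rat t) \<alpha> * ev h = 1"
      using inverse_if_not_dvd by blast
    \<comment> \<open>The inverse of \<open>ev h\<close> is \<open>ev k / n\<close>, and
      \<open>x\<close> is \<open>ev h / N\<close>, so the inverse of \<open>x\<close> is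
      \<open>N * ev k / n\<close>.\<close>
    obtain n k where nk: "n \<noteq> 0" "[:of_int n:] * t = map_poly of_int k"
      by (rule clear_denominators)
    have "ev k = of_int n * poly (map_poly of_rat t) \<alpha>"
      unfolding ev_eq_poly_of_rat nk(2)[symmetric] by (simp add: hom_distribs)
    hence "ev k * ev h = of_int n" using t by (simp add: mult.assoc)
    hence "of_int n * inverse x = ev (of_int N * k)"
      using * False by (simp add: ev_hom field_simps flip: *(2))
    thus ?thesis using nk(1) by (intro SI)
  qed (use that in simp)
  have "is_subfield S"
    using add mult minus inverse SI[of 1 0 0] SI[of 1 1 1] unfolding is_subfield_def by (simp add: ev_hom)
  moreover have "\<alpha> \<in> S" by (rule SI[of 1 _ "[:0, 1:]"]) (simp_all add: map_poly_pCons)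
  ultimately have "rat_adjoin \<alpha> \<subseteq> S"
    unfolding rat_adjoin_def by (intro hull_minimal) auto
  thus ?thesis using assms that unfolding S_def by blast
qed

text \<open>The coefficients range over \<int>[\<alpha>] instead of \<int>, so that multiplying
  \<open>x\<close> by an element of \<int>[\<alpha>] only rescales the equation.\<close>

definition integral :: "'a \<Rightarrow> bool" where
  "integral x \<longleftrightarrow> (\<exists>n c. x ^ n = (\<Sum>i<n. ev (c i) * x ^ i))"

lemma integral_if_algebraic_int:
  assumes "algebraic_int x"
  shows "integral x"
proof -
  obtain q where q: "poly (map_poly of_int q) x = 0" "lead_coeff q = 1"
    using assms unfolding algebraic_int_altdef_ipoly by blast
  define n where "n = degree q"
  have "0 = (\<Sum>i\<le>n. of_int (coeff q i) * x ^ i)"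
    using q by (simp add: poly_altdef n_def)
  also have "\<dots> = (\<Sum>i<n. of_int (coeff q i) * x ^ i) + x ^ n"
    using q(2) by (simp add: n_def flip: lessThan_Suc_atMost)
  finally have "x ^ n = (\<Sum>i<n. ev (of_int (- coeff q i)) * x ^ i)"
    by (simp add: ev_hom sum_negf eq_neg_iff_add_eq_0 add.commute)
  thus ?thesis unfolding integral_def by (intro exI)
qed

lemma integral_scaled:
  assumes "x ^ n = (\<Sum>i<n. ev (c i) * x ^ i)"
  shows "(ev r * x) ^ n = (\<Sum>i<n. ev (c i * r ^ (n - i)) * (ev r * x) ^ i)"
proof -
  have "(ev r * x) ^ n = (\<Sum>i<n. ev r ^ n * (ev (c i) * x ^ i))"
    by (simp add: power_mult_distrib assms sum_distrib_left)
  also have "\<dots> = (\<Sum>i<n. ev (c i * r ^ (n - i)) * (ev r * x) ^ i)"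
  proof (rule sum.cong)
    fix i assume "i \<in> {..<n}"
    hence "ev r ^ n = ev r ^ (n - i) * ev r ^ i" by (simp flip: power_add)
    thus "ev r ^ n * (ev (c i) * x ^ i) = ev (c i * r ^ (n - i)) * (ev r * x) ^ i"
      by (simp add: ev_hom power_mult_distrib algebra_simps)
  qed simp
  finally show ?thesis .
qed

lemma integral_mult_ev:
  assumes "integral x"
  shows "integral (ev r * x)"
proof -
  obtain n c where "x ^ n = (\<Sum>i<n. ev (c i) * x ^ i)"
    using assms unfolding integral_def by blast
  from integral_scaled[OF this, of r] show ?thesis
    unfolding integral_def by (intro exI)
qed

text \<open>After multiplying the equation of \<open>x\<close> by the \<open>n\<close>-th power of
  \<open>s\<close>, every term with \<open>i < n\<close> still has a factor \<open>s\<close>. So a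
  power of \<open>m\<close> lies in the ideal \<open>(s, F)\<close>; a prime ideal containing
  \<open>s\<close> and \<open>F\<close> then contains \<open>m\<close>.\<close>

lemma integral_power_dvd:
  assumes "integral x" and sx: "ev s * x = ev m"
  obtains n t k where "m ^ n = s * t + F * k"
proof -
  obtain n c where "x ^ n = (\<Sum>i<n. ev (c i) * x ^ i)"
    using assms(1) unfolding integral_def by blast
  from integral_scaled[OF this, of s]
  have "ev (m ^ n) = (\<Sum>i<n. ev (c i * s ^ (n - i)) * ev m ^ i)"
    unfolding sx by (simp add: ev_hom)
  also have "\<dots> = (\<Sum>i<n. ev s * ev (c i * s ^ (n - i - 1) * m ^ i))"
  proof (rule sum.cong)
    fix i assume "i \<in> {..<n}"
    hence "n - i = Suc (n - i - 1)" by simp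
    hence "s ^ (n - i) = s * s ^ (n - i - 1)" by (metis power_Suc)
    thus "ev (c i * s ^ (n - i)) * ev m ^ i = ev s * ev (c i * s ^ (n - i - 1) * m ^ i)"
      by (simp add: ev_hom algebra_simps)
  qed simp
  also have "\<dots> = ev (s * (\<Sum>i<n. c i * s ^ (n - i - 1) * m ^ i))" (is "_ = ev (s * ?t)")
    unfolding ev_hom(4)[of s] ev_hom(9) by (simp only: sum_distrib_left)
  finally have "F dvd m ^ n - s * ?t" by (simp add: ev_eq_iff)
  then obtain k where "m ^ n - s * ?t = F * k" by blast
  hence "m ^ n = s * ?t + F * k" by (simp add: algebra_simps)
  thus ?thesis by (rule that)
qed

text \<open>Take the least positive \<open>n\<close> with \<open>n * x\<close> in \<int>[\<alpha>]
  and a prime factor \<open>p\<close> of it; minimality keeps \<open>(n / p) * x\<close>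
  outside.\<close>

lemma prime_denominator:
  assumes x: "x \<in> ring_of_integers (rat_adjoin \<alpha>)" "x \<notin> int_adjoin \<alpha>"
  obtains p :: int and y where "prime p" "integral y" "y \<notin> int_adjoin \<alpha>" "of_int p * y \<in> int_adjoin \<alpha>"
proof -
  obtain N h where N: "N \<noteq> 0" "of_int N * x = ev h"
    using x(1) rat_adjoin_denominator unfolding ring_of_integers_def by blast
  have "of_int \<bar>N\<bar> * x \<in> int_adjoin \<alpha>"
    using N(2) ev_in_int_adjoin[of h] ev_in_int_adjoin[of "- h"] by (auto simp: abs_if ev_hom)
  define Q where "Q n \<longleftrightarrow> n > 0 \<and> of_nat n * x \<in> int_adjoin \<alpha>" for n :: nat
  have "Q (nat \<bar>N\<bar>)" unfolding Q_def using N(1) \<open>of_int \<bar>N\<bar> * x \<in> int_adjoin \<alpha>\<close> by simp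
  define n where "n = (LEAST n. Q n)"
  have n: "Q n" and min: "\<And>m. m < n \<Longrightarrow> \<not> Q m"
    unfolding n_def using LeastI[of Q] not_less_Least \<open>Q (nat \<bar>N\<bar>)\<close> by blast+
  have "n \<noteq> 1" using n x(2) by (auto simp: Q_def)
  then obtain p where p: "prime p" "p dvd n" using prime_factor_nat by blast
  then obtain m where m: "n = p * m" by blast
  have "m > 0" "m < n" using n p(1) prime_gt_1_nat[of p] by (auto simp: m Q_def)
  define y where "y = of_nat m * x"
  have "y \<notin> int_adjoin \<alpha>" using min[OF \<open>m < n\<close>] \<open>m > 0\<close> by (simp add: Q_def y_def)
  moreover have "of_int (int p) * y \<in> int_adjoin \<alpha>"
    using n by (simp add: Q_def m y_def mult.assoc)
  moreover have "integral (ev (of_int (int m)) * x)"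
    using x(1) by (intro integral_mult_ev integral_if_algebraic_int) (simp add: ring_of_integers_def)
  hence "integral y" unfolding ev_hom y_def by simp
  moreover have "prime (int p)" using p by simp
  ultimately show ?thesis using that by blast
qed

theorem square_ideal_if_not_integrally_closed:
  assumes "int_adjoin \<alpha> \<noteq> ring_of_integers (rat_adjoin \<alpha>)"
  obtains p f I g u v where "poly_prime_ideal p f I"
    "F = f ^ 2 * g + of_int p * f * u + of_int p ^ 2 * v"
proof -
  obtain x where "x \<in> ring_of_integers (rat_adjoin \<alpha>)" "x \<notin> int_adjoin \<alpha>"
    using assms int_adjoin_subset_integers by blast
  then obtain p y where p: "prime p" and y: "integral y" "y \<notin> int_adjoin \<alpha>" "of_int p * y \<in> int_adjoin \<alpha>"
    using prime_denominator by metis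
  define G where "G z \<longleftrightarrow> integral z \<and> z \<notin> int_adjoin \<alpha> \<and> of_int p * z \<in> int_adjoin \<alpha>" for z
  \<comment> \<open>The degree is minimised over \<open>z\<close> and \<open>f\<close> together: the
    primality proof applies minimality to \<open>ev t * z\<close> as well.\<close>
  define Q where "Q d \<longleftrightarrow> (\<exists>z f. G z \<and> lead_coeff f = 1 \<and> degree f = d \<and> ev f * z \<in> int_adjoin \<alpha>)" for d
  have "Q (degree F)" unfolding Q_def
    using y monic root ev_in_int_adjoin[of 0] by (intro exI[of _ y] exI[of _ F]) (auto simp: G_def)
  define d where "d = (LEAST d. Q d)"
  have d: "Q d" and min: "\<And>m. m < d \<Longrightarrow> \<not> Q m"
    unfolding d_def using LeastI[of Q] not_less_Least \<open>Q (degree F)\<close> by blast+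
  obtain z f where z: "G z" and f: "lead_coeff f = 1" "degree f = d" "ev f * z \<in> int_adjoin \<alpha>"
    using d unfolding Q_def by blast
  define I where "I = {h. \<exists>u v. h = f * u + of_int p * v}"
  have R_add: "s + t \<in> int_adjoin \<alpha>" and R_diff: "s - t \<in> int_adjoin \<alpha>"
    and R_mult: "s * t \<in> int_adjoin \<alpha>" if "s \<in> int_adjoin \<alpha>" "t \<in> int_adjoin \<alpha>" for s t
    using that by (auto elim!: int_adjoinE simp flip: ev_hom)
  \<comment> \<open>By minimality of the degree of \<open>f\<close>, the ideal \<open>(p, f)\<close> is the annihilator of
    every \<open>z'\<close> that \<open>f\<close> kills modulo \<open>\<int>[\<alpha>]\<close>; such maximal annihilators are prime.\<close>
  have ann: "ev s * z' \<in> int_adjoin \<alpha> \<longleftrightarrow> s \<in> I"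
    if z': "G z'" "ev f * z' \<in> int_adjoin \<alpha>" for s z'
  proof
    assume "s \<in> I"
    then obtain u v where uv: "s = f * u + of_int p * v" unfolding I_def by blast
    have "ev s * z' = ev u * (ev f * z') + ev v * (of_int p * z')"
      by (simp add: uv ev_hom algebra_simps)
    thus "ev s * z' \<in> int_adjoin \<alpha>"
      using z' unfolding G_def by (auto intro!: R_add R_mult)
  next
    assume s: "ev s * z' \<in> int_adjoin \<alpha>"
    obtain q r where qr: "s = f * q + r" "r = 0 \<or> degree r < degree f"
      using monic_division[OF f(1)] by blast
    have "ev r * z' = ev s * z' - ev q * (ev f * z')" by (simp add: qr(1) ev_hom algebra_simps)
    hence r: "ev r * z' \<in> int_adjoin \<alpha>" using s z' by (auto intro!: R_diff R_mult)
    \<comment> \<open>Otherwise a multiple of \<open>r\<close> is monic modulo \<open>p\<close> and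
      yields a monic polynomial of degree below \<open>d\<close> that kills \<open>z'\<close> modulo
      \<int>[\<alpha>].\<close>
    have "[:p:] dvd r"
    proof (rule ccontr)
      assume nd: "\<not> [:p:] dvd r"
      from monic_multiple_mod_prime[OF p nd] obtain c q' r'
        where c: "[:c:] * r = r' + [:p:] * q'" and r': "lead_coeff r' = 1" "degree r' \<le> degree r" .
      have r'_eq: "r' = of_int c * r - of_int p * q'" using c by (simp add: of_int_poly)
      have "ev r' * z' = ev (of_int c) * (ev r * z') - ev q' * (of_int p * z')"
        unfolding r'_eq by (simp add: ev_hom algebra_simps)
      also have "\<dots> \<in> int_adjoin \<alpha>" using r z'(1) unfolding G_def by (auto intro!: R_diff R_mult simp del: of_int_poly)
      finally have "Q (degree r')" unfolding Q_def using z'(1) r'(1) by blast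
      moreover have "degree r' < d" using r'(2) qr(2) nd f(2) by auto
      ultimately show False using min by blast
    qed
    then obtain v where "r = [:p:] * v" by blast
    hence "s = f * q + of_int p * v" by (simp add: qr(1) of_int_poly)
    thus "s \<in> I" unfolding I_def by blast
  qed
  interpret poly_prime_ideal p f I
  proof
    show "1 \<notin> I" using ann[OF z f(3), of 1] z by (simp add: G_def)
    fix s t assume st: "s * t \<in> I"
    show "s \<in> I \<or> t \<in> I"
    proof (rule disjCI)
      assume t: "t \<notin> I"
      have "ev t * z \<notin> int_adjoin \<alpha>" using ann[OF z f(3)] t by blast
      moreover have "ev t * (of_int p * z) \<in> int_adjoin \<alpha>" "ev t * (ev f * z) \<in> int_adjoin \<alpha>"
        using z f(3) unfolding G_def by (auto intro: R_mult)
      ultimately have "G (ev t * z)" and "ev f * (ev t * z) \<in> int_adjoin \<alpha>"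
        using z integral_mult_ev unfolding G_def by (simp_all add: mult.left_commute)
      from ann[OF this, of s] show "s \<in> I"
        using ann[OF z f(3), of "s * t"] st by (simp add: ev_hom mult.assoc)
    qed
  qed (use p f I_def in auto)
  have F_in: "F \<in> I" using ann[OF z f(3), of F] root ev_in_int_adjoin[of 0] by simp
  \<comment> \<open>It remains to show that \<open>q\<close> and \<open>M\<close> lie in
    \<open>I\<close>. Both follow from \<open>q * k\<close> and \<open>M * k\<close> being in
    \<open>I\<close> for one polynomial \<open>k\<close> outside \<open>I\<close>.\<close>
  then obtain q M where qM: "F = f * q + of_int p * M" unfolding I_def by blast
  obtain h where h: "of_int p * z = ev h" using z int_adjoinE unfolding G_def by blast
  obtain l where l: "ev f * z = ev l" using f(3) int_adjoinE by blast
  have "ev (f * h) = ev (of_int p * l)"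
    by (simp add: ev_hom flip: h l)
  then obtain k where k: "f * h - of_int p * l = F * k" by (auto simp: ev_eq_iff)
  have "f * (h - q * k) = of_int p * (l + M * k)"
    using k unfolding qM by (simp add: algebra_simps)
  hence "of_int p dvd f * (h - q * k)" by simp
  hence "of_int p dvd h - q * k"
    using prime_elem_p p_not_dvd_f prime_elem_dvd_multD by blast
  then obtain e where "h - q * k = of_int p * e" by blast
  hence e: "h = q * k + of_int p * e" by (simp add: algebra_simps)
  have p0: "(of_int p :: 'a) \<noteq> 0" using p by auto
  \<comment> \<open>If \<open>k\<close> were in \<open>I\<close>, then \<open>h\<close> would be a
    multiple of \<open>p\<close> modulo \<open>F\<close>, which puts \<open>z\<close> in
    \<int>[\<alpha>].\<close>
  have k_notin: "k \<notin> I"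
  proof
    assume "k \<in> I"
    then obtain u v where uv: "k = f * u + of_int p * v" unfolding I_def by blast
    have "h = F * u + of_int p * (q * v + e - M * u)"
      unfolding e uv qM by (simp add: algebra_simps)
    hence "of_int p * z = of_int p * ev (q * v + e - M * u)"
      by (simp add: h ev_hom root)
    hence "z = ev (q * v + e - M * u)" using p0 by simp
    thus False using z ev_in_int_adjoin unfolding G_def by metis
  qed
  have I_combination: "f * t + F * k' \<in> I" "of_int p * t + F * k' \<in> I" for t k'
    by (intro ideal_add ideal_mult f_in_ideal F_in p_in_ideal)+
  have int_z: "integral z" using z by (simp add: G_def)
  \<comment> \<open>Clearing the equation of \<open>z\<close> with \<open>p\<close> puts
    \<open>h\<close>, and with it \<open>q * k\<close>, into \<open>I\<close>.\<close>
  have "ev (of_int p) * z = ev h" using h by (simp add: ev_hom)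
  from integral_power_dvd[OF int_z this] have "h \<in> I"
    using I_combination prime_power by metis
  moreover have "q * k = h - of_int p * e" by (simp add: e)
  ultimately have "q * k \<in> I" by (auto intro: ideal_diff ideal_mult p_in_ideal)
  hence "q \<in> I" using prime_I k_notin by blast
  then obtain g u' where q: "q = f * g + of_int p * u'" unfolding I_def by blast
  have fh: "f * h = F * k + of_int p * (f * e - M * k)"
    unfolding e qM by (simp add: algebra_simps)
  \<comment> \<open>Now \<open>f\<close> takes the place of \<open>p\<close>:
    \<open>f * e - M * k\<close> represents \<open>ev f * z\<close>, and the same argument puts it,
    hence \<open>M * k\<close>, into \<open>I\<close>.\<close>
  have "of_int p * (ev f * z) = ev (f * h)" by (simp add: ev_hom flip: h)
  also have "\<dots> = of_int p * ev (f * e - M * k)"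
    unfolding fh by (simp only: ev_hom(1,4,8) root mult_zero_left add_0)
  finally have "ev f * z = ev (f * e - M * k)" using p0 by simp
  from integral_power_dvd[OF int_z this] have "f * e - M * k \<in> I"
    using I_combination prime_power by metis
  from ideal_diff[OF ideal_mult[OF f_in_ideal] this] have "f * e - (f * e - M * k) \<in> I" .
  hence "M * k \<in> I" by simp
  hence "M \<in> I" using prime_I k_notin by blast
  then obtain u v where M: "M = f * u + of_int p * v" unfolding I_def by blast
  have "F = f ^ 2 * g + of_int p * f * (u + u') + of_int p ^ 2 * v"
    unfolding qM q M by (simp add: algebra_simps power2_eq_square)
  thus ?thesis using that poly_prime_ideal_axioms by blast
qed

end

section \<open>The trinomial\<close>

lemma padic_val_le_1_iff:
  assumes "prime p"
  shows "padic_val p n \<le> 1 \<longleftrightarrow> \<not> p ^ 2 dvd n"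
proof (cases "n = 0")
  case False
  have "p ^ 2 dvd n \<longleftrightarrow> 2 \<le> multiplicity p n"
    using False assms by (intro power_dvd_iff_le_multiplicity) auto
  thus ?thesis using False by (auto simp: padic_val_def one_enat_def)
qed (simp add: padic_val_def)

lemma padic_val_eq_1_iff:
  assumes "prime p"
  shows "padic_val p n = 1 \<longleftrightarrow> p dvd n \<and> \<not> p ^ 2 dvd n"
proof (cases "n = 0")
  case False
  have "p ^ 2 dvd n \<longleftrightarrow> 2 \<le> multiplicity p n" "p ^ 1 dvd n \<longleftrightarrow> 1 \<le> multiplicity p n"
    using False assms by (intro power_dvd_iff_le_multiplicity; auto)+
  thus ?thesis using False by (auto simp: padic_val_def one_enat_def)
qed (simp add: padic_val_def one_enat_def)

definition X :: "int poly" where "X = [:0, 1:]"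

lemma pderiv_X: "pderiv X = 1"
  by (simp add: X_def pderiv_pCons)

lemma trinomial_eq: "monom 1 7 + monom a 1 + monom b 0 = X ^ 7 + of_int a * X + of_int (b :: int)"
  by (simp add: monom_altdef of_int_poly X_def)

text \<open>Modulo \<open>m\<close>, \<open>c\<close> plays the role of
  \<open>- 7 b / (6 a)\<close>. With D = 7^7 b^6 + 6^6 a^7, the discriminant up to sign, clearing
  denominators gives (6a)^7 F(c) = - b D and (6a)^6 F'(c) = D.\<close>

lemma trinomial_at_double_root:
  fixes a b c m :: int
  assumes "6 * a * c = - 7 * b + m"
  shows "m dvd 6 ^ 7 * a ^ 7 * (c ^ 7 + a * c + b) + b * (7 ^ 7 * b ^ 6 + 6 ^ 6 * a ^ 7)"
    and "m dvd 6 ^ 6 * a ^ 6 * (7 * c ^ 6 + a) - (7 ^ 7 * b ^ 6 + 6 ^ 6 * a ^ 7)"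
proof -
  have cong: "[6 * a * c = - 7 * b] (mod m)" using assms by (simp add: cong_iff_dvd_diff)
  have "[(6 * a * c) ^ 7 + 6 ^ 6 * a ^ 7 * (6 * a * c) + 6 ^ 7 * a ^ 7 * b
      = (- 7 * b) ^ 7 + 6 ^ 6 * a ^ 7 * (- 7 * b) + 6 ^ 7 * a ^ 7 * b] (mod m)"
    by (intro cong_add cong_mult cong_pow cong cong_refl)
  moreover have "6 ^ 7 * a ^ 7 * (c ^ 7 + a * c + b) + b * (7 ^ 7 * b ^ 6 + 6 ^ 6 * a ^ 7)
      = (6 * a * c) ^ 7 + 6 ^ 6 * a ^ 7 * (6 * a * c) + 6 ^ 7 * a ^ 7 * b
        - ((- 7 * b) ^ 7 + 6 ^ 6 * a ^ 7 * (- 7 * b) + 6 ^ 7 * a ^ 7 * b)"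
    by (simp add: algebra_simps eval_nat_numeral)
  ultimately show "m dvd 6 ^ 7 * a ^ 7 * (c ^ 7 + a * c + b) + b * (7 ^ 7 * b ^ 6 + 6 ^ 6 * a ^ 7)"
    unfolding cong_iff_dvd_diff by metis
  have "[7 * (6 * a * c) ^ 6 + 6 ^ 6 * a ^ 7 = 7 * (- 7 * b) ^ 6 + 6 ^ 6 * a ^ 7] (mod m)"
    by (intro cong_add cong_mult cong_pow cong cong_refl)
  moreover have "6 ^ 6 * a ^ 6 * (7 * c ^ 6 + a) - (7 ^ 7 * b ^ 6 + 6 ^ 6 * a ^ 7)
      = 7 * (6 * a * c) ^ 6 + 6 ^ 6 * a ^ 7 - (7 * (- 7 * b) ^ 6 + 6 ^ 6 * a ^ 7)"
    by (simp add: algebra_simps eval_nat_numeral)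
  ultimately show "m dvd 6 ^ 6 * a ^ 6 * (7 * c ^ 6 + a) - (7 ^ 7 * b ^ 6 + 6 ^ 6 * a ^ 7)"
    unfolding cong_iff_dvd_diff by metis
qed

text \<open>Division by the square of \<open>x - c\<close>: the remainder is F'(c) (x - c) +
  F(c).\<close>

lemma trinomial_taylor:
  fixes x a b c :: "'r :: comm_ring_1"
  shows "x ^ 7 + a * x + b = (x - c) ^ 2 * (x ^ 5 + 2 * c * x ^ 4 + 3 * c ^ 2 * x ^ 3 + 4 * c ^ 3 * x ^ 2
      + 5 * c ^ 4 * x + 6 * c ^ 5) + (7 * c ^ 6 + a) * (x - c) + (c ^ 7 + a * c + b)"
  by (simp add: algebra_simps eval_nat_numeral)

lemma trinomial_derivative_taylor:
  fixes x a c :: "'r :: comm_ring_1"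
  shows "7 * c ^ 6 + a = 7 * x ^ 6 + a - (x - c) * (7 * (x ^ 5 + x ^ 4 * c + x ^ 3 * c ^ 2 + x ^ 2 * c ^ 3
      + x * c ^ 4 + c ^ 5))"
  by (simp add: algebra_simps eval_nat_numeral)

lemma seven_dvd_power_diff: "7 dvd b ^ 7 - (b :: int)"
proof -
  have "b mod 7 \<in> {0..<7}" by simp
  hence "b mod 7 = 0 \<or> b mod 7 = 1 \<or> b mod 7 = 2 \<or> b mod 7 = 3 \<or> b mod 7 = 4 \<or> b mod 7 = 5 \<or> b mod 7 = 6"
    by auto
  hence "(b mod 7) ^ 7 mod 7 = b mod 7"
    by (elim disjE) simp_all
  hence "b ^ 7 mod 7 = b mod 7" by (simp only: power_mod)
  thus ?thesis by (simp only: mod_eq_dvd_iff)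
qed

text \<open>-1 is not a square modulo 3.\<close>

lemma three_dvd_sum_squares:
  fixes s t :: int
  assumes "3 dvd s ^ 2 + t ^ 2"
  shows "3 dvd s \<and> 3 dvd t"
proof -
  have "((s mod 3) ^ 2 + (t mod 3) ^ 2) mod 3 = 0"
    using assms mod_add_eq[of "s ^ 2" 3 "t ^ 2"] mod_add_eq[of "(s mod 3) ^ 2" 3 "(t mod 3) ^ 2"]
    unfolding power_mod dvd_eq_mod_eq_0 by argo
  moreover have "s mod 3 = 0 \<or> s mod 3 = 1 \<or> s mod 3 = 2" "t mod 3 = 0 \<or> t mod 3 = 1 \<or> t mod 3 = 2"
    by presburger+
  ultimately have "s mod 3 = 0 \<and> t mod 3 = 0" by (elim disjE) simp_all
  thus ?thesis by (simp add: dvd_eq_mod_eq_0)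
qed

lemma prime_not_dvd_6_mult:
  fixes p a :: int
  assumes p: "prime p" "p \<notin> {2, 3}" "\<not> p dvd a"
  shows "\<not> p dvd 6 * a"
proof
  assume "p dvd 6 * a"
  hence "p dvd (2 * 3) * a" by simp
  hence "p dvd 2 \<or> p dvd 3" using p by (simp only: prime_dvd_mult_iff simp_thms)
  hence "p \<le> 3" using zdvd_imp_le[of p 2] zdvd_imp_le[of p 3] by auto
  thus False using prime_ge_2_int[OF p(1)] p(2) by auto
qed

text \<open>\<open>6 * a\<close> is invertible modulo \<open>p ^ 2\<close>. Working to that
  precision lets \<open>p ^ 2\<close> be compared in F(c) and in the discriminant.\<close>

lemma approximate_double_root:
  fixes p a b :: int
  assumes p: "prime p" "p \<notin> {2, 3}" "\<not> p dvd a"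
  obtains c k where "6 * a * c = - 7 * b + p ^ 2 * k"
proof -
  have "coprime (6 * a) (p ^ 2)"
    by (rule prime_imp_power_coprime[OF p(1) prime_not_dvd_6_mult[OF p]])
  then obtain c where "[6 * a * c = 1] (mod p ^ 2)" using cong_solve_coprime_int by blast
  then obtain k where k: "6 * a * c = 1 + p ^ 2 * k" by (metis cong_iff_lin cong_sym)
  have "6 * a * (- 7 * b * c) = - 7 * b * (6 * a * c)" by simp
  also have "\<dots> = - 7 * b + p ^ 2 * (- 7 * b * k)" unfolding k by (simp add: algebra_simps)
  finally show ?thesis by (rule that)
qed

section \<open>Consequences of the trinomial lying in the square of a prime ideal\<close>

context poly_prime_ideal
begin

context
  fixes a b :: int
  assumes F: "X ^ 7 + of_int a * X + of_int b \<in> I2"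
begin

lemma derivative_mem: "7 * X ^ 6 + of_int a \<in> I"
proof -
  have "pderiv (X ^ 7 + of_int a * X + of_int b) = 7 * X ^ 6 + of_int a"
    by (simp add: pderiv_add pderiv_mult pderiv_power pderiv_X pderiv_smult of_int_poly numeral_poly)
  thus ?thesis using pderiv_mem[OF F] by simp
qed

lemma linear_mem: "of_int (6 * a) * X + of_int (7 * b) \<in> I"
proof -
  have "of_int (6 * a) * X + of_int (7 * b) =
      7 * (X ^ 7 + of_int a * X + of_int b) - X * (7 * X ^ 6 + of_int a)"
    by (simp add: algebra_simps eval_nat_numeral)
  also have "\<dots> \<in> I"
    by (intro ideal_diff ideal_mult' ideal2_subset[OF F] derivative_mem)
  finally show ?thesis .
qed

lemma X_notin:
  assumes "\<not> p dvd a"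
  shows "X \<notin> I"
proof
  assume "X \<in> I"
  hence "7 * X ^ 6 + of_int a - X * (7 * X ^ 5) \<in> I"
    by (intro ideal_diff ideal_mult derivative_mem)
  moreover have "7 * X ^ 6 + of_int a - X * (7 * X ^ 5) = of_int a"
    by (simp add: algebra_simps eval_nat_numeral)
  ultimately show False using assms by (simp add: of_int_mem_iff)
qed

text \<open>F'(c) is in \<open>I\<close> because it agrees with F' modulo \<open>X - c\<close>. In
  the Taylor expansion F(c) is therefore a combination of elements of \<open>I2\<close>, and an
  integer in \<open>I2\<close> is divisible by \<open>p ^ 2\<close>.\<close>

lemma square_dvd_at_root:
  assumes c: "X - of_int c \<in> I"
  shows "p ^ 2 dvd c ^ 7 + a * c + b"
proof -
  have "of_int (7 * c ^ 6 + a) = 7 * X ^ 6 + of_int a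
      - (X - of_int c) * (7 * (X ^ 5 + X ^ 4 * of_int c + X ^ 3 * of_int c ^ 2 + X ^ 2 * of_int c ^ 3
        + X * of_int c ^ 4 + of_int c ^ 5))"
    unfolding of_int_add of_int_mult of_int_power of_int_numeral by (rule trinomial_derivative_taylor)
  also have "\<dots> \<in> I" by (intro ideal_diff ideal_mult derivative_mem c)
  finally have der: "of_int (7 * c ^ 6 + a) \<in> I" .
  define G where "G = X ^ 5 + 2 * of_int c * X ^ 4 + 3 * of_int c ^ 2 * X ^ 3 + 4 * of_int c ^ 3 * X ^ 2
        + 5 * of_int c ^ 4 * X + 6 * of_int c ^ 5"
  have eq: "of_int (c ^ 7 + a * c + b) = X ^ 7 + of_int a * X + of_int b
      - of_int (7 * c ^ 6 + a) * (X - of_int c) - (X - of_int c) * ((X - of_int c) * G)"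
    unfolding of_int_add of_int_mult of_int_power of_int_numeral G_def
    by (subst trinomial_taylor[of X "of_int a" "of_int b" "of_int c"])
       (simp only: power2_eq_square mult.assoc add_diff_cancel_left' add_diff_cancel_right' diff_diff_eq add.assoc add.commute)
  have "of_int (c ^ 7 + a * c + b) \<in> I2" unfolding eq
    by (intro ideal2_diff mult_mem_ideal2 F c ideal_mult der)
  moreover from ideal2_subset[OF this] have "p dvd c ^ 7 + a * c + b"
    by (simp only: of_int_mem_iff)
  ultimately show ?thesis by (rule of_int_mem_ideal2)
qed

text \<open>Modulo \<open>p\<close> the trinomial is X^7, so the double root is 0.\<close>

lemma square_dvd_if_common_divisor:
  assumes "p dvd a" "p dvd b"
  shows "p ^ 2 dvd b"
proof -
  have "X ^ 7 = X ^ 7 + of_int a * X + of_int b - (of_int a * X + of_int b)" by simp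
  also have "\<dots> \<in> I"
    by (intro ideal_diff ideal_add ideal_mult ideal2_subset[OF F]) (use assms of_int_mem_iff in auto)
  finally have "X \<in> I" by (rule prime_power)
  thus ?thesis using square_dvd_at_root[of 0] by simp
qed

text \<open>Modulo 2 the trinomial is X (X^3 + 1)^2, so \<open>w\<close> is in \<open>I\<close>.
  Removing \<open>X * w ^ 2\<close> leaves \<open>2 * m\<close> in \<open>I2\<close>, hence
  \<open>m\<close> in \<open>I\<close>, and \<open>m\<close> is the claimed linear polynomial modulo
  \<open>w\<close>. Both factors of X^3 + 1 modulo 2 are covered at once.\<close>

lemma double_root_mod_2:
  assumes p: "p = 2" and a: "a = 2 * s - 1" and b: "b = 2 * t"
  shows "of_int s * X + of_int t \<in> I"
proof -
  have "\<not> p dvd a" unfolding p a by presburger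
  hence X: "X \<notin> I" by (rule X_notin)
  define w where "w = X ^ 3 + 1"
  define m where "m = of_int s * X + of_int t - X * w"
  have eq: "X ^ 7 + of_int a * X + of_int b = (X * w) * w + of_int p * m"
    unfolding w_def m_def p a b by (simp add: algebra_simps eval_nat_numeral)
  have "(X * w) * w = X ^ 7 + of_int a * X + of_int b - of_int p * m" by (simp add: eq)
  also have "\<dots> \<in> I" by (intro ideal_diff ideal_mult p_in_ideal ideal2_subset[OF F])
  finally have w: "w \<in> I" using prime_I X by blast
  have "of_int p * m = X ^ 7 + of_int a * X + of_int b - (X * w) * w" by (simp add: eq)
  also have "\<dots> \<in> I2" by (intro ideal2_diff mult_mem_ideal2 F w ideal_mult'[OF w])
  finally have "m \<in> I" by (rule ideal2_cancel_p)
  from ideal_add[OF this ideal_mult'[OF w, of X]] show ?thesis by (simp add: m_def)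
qed

text \<open>Modulo 3, X^7 - X is X (X - 1)^3 (X + 1)^3.\<close>

lemma double_roots_mod_3:
  assumes p: "p = 3" and a: "a = 3 * s - 1" and b: "b = 3 * t"
  shows "X - of_int 1 \<in> I \<or> X - of_int (-1) \<in> I"
proof -
  have "\<not> p dvd a" unfolding p a by presburger
  hence X: "X \<notin> I" by (rule X_notin)
  have "X * ((X - of_int 1) ^ 3 * (X - of_int (-1)) ^ 3) = X ^ 7 + of_int a * X + of_int b
      - of_int p * (X ^ 5 - X ^ 3 + of_int s * X + of_int t)"
    unfolding p a b by (simp add: algebra_simps eval_nat_numeral)
  also have "\<dots> \<in> I" by (intro ideal_diff ideal_mult p_in_ideal ideal2_subset[OF F])
  finally show ?thesis using prime_I X prime_power by blast
qed

text \<open>Modulo 3 the trinomial is X (X^2 + 1)^3, and removing this product leaves a linear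
  polynomial in \<open>I\<close>, as for the prime 2.\<close>

lemma quadratic_factor_mod_3:
  assumes p: "p = 3" and a: "a = 3 * s + 1" and b: "b = 3 * t"
  shows "3 dvd s \<and> 3 dvd t"
proof -
  have "\<not> p dvd a" unfolding p a by presburger
  hence X: "X \<notin> I" by (rule X_notin)
  define w where "w = X ^ 2 + 1"
  define m where "m = of_int s * X + of_int t - X ^ 3 * w"
  have eq: "X ^ 7 + of_int a * X + of_int b = (X * w * w) * w + of_int p * m"
    unfolding w_def m_def p a b by (simp add: algebra_simps eval_nat_numeral)
  have "(X * w * w) * w = X ^ 7 + of_int a * X + of_int b - of_int p * m" by (simp add: eq)
  also have "\<dots> \<in> I" by (intro ideal_diff ideal_mult p_in_ideal ideal2_subset[OF F])
  finally have w: "w \<in> I" using prime_I X by blast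
  have "of_int p * m = X ^ 7 + of_int a * X + of_int b - (X * w * w) * w" by (simp add: eq)
  also have "\<dots> \<in> I2" by (intro ideal2_diff mult_mem_ideal2 F w ideal_mult'[OF w])
  finally have "m \<in> I" by (rule ideal2_cancel_p)
  from ideal_add[OF this ideal_mult'[OF w, of "X ^ 3"]]
  have lin: "of_int s * X + of_int t \<in> I" by (simp add: m_def)
  \<comment> \<open>X is a square root of -1 modulo \<open>w\<close>, so the product with the
    conjugate gives the norm.\<close>
  have "of_int (s ^ 2 + t ^ 2) = of_int s ^ 2 * w
      - (of_int s * X + of_int t) * (of_int s * X - of_int t)"
    unfolding w_def by (simp add: algebra_simps power2_eq_square)
  also have "\<dots> \<in> I" by (intro ideal_diff ideal_mult'[OF w] ideal_mult[OF lin])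
  finally have "3 dvd s ^ 2 + t ^ 2" by (simp only: of_int_mem_iff p)
  thus ?thesis by (rule three_dvd_sum_squares)
qed

text \<open>By Fermat and the Frobenius map, X^7 + b is (X + b)^7 modulo 7.\<close>

lemma multiple_root_mod_7:
  assumes p: "p = 7" and a: "7 dvd a"
  shows "X - of_int (- b) \<in> I"
proof -
  obtain s where s: "a = 7 * s" using a by blast
  obtain t where "b ^ 7 - b = 7 * t" using seven_dvd_power_diff by blast
  hence "b ^ 7 = b + 7 * t" by simp
  hence b: "(of_int b :: int poly) ^ 7 = of_int b + 7 * of_int t"
    by (metis of_int_add of_int_mult of_int_numeral of_int_power)
  define B where "B = (of_int b :: int poly)"
  have "(X + B) ^ 7 = X ^ 7 + 7 * (X ^ 6 * B + 3 * X ^ 5 * B ^ 2 + 5 * X ^ 4 * B ^ 3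
      + 5 * X ^ 3 * B ^ 4 + 3 * X ^ 2 * B ^ 5 + X * B ^ 6) + B ^ 7"
    by (simp add: algebra_simps eval_nat_numeral)
  also have "B ^ 7 = B + 7 * of_int t" using b by (simp add: B_def)
  also have "X ^ 7 + 7 * (X ^ 6 * B + 3 * X ^ 5 * B ^ 2 + 5 * X ^ 4 * B ^ 3
      + 5 * X ^ 3 * B ^ 4 + 3 * X ^ 2 * B ^ 5 + X * B ^ 6) + (B + 7 * of_int t) =
      X ^ 7 + of_int a * X + of_int b + of_int p * (X ^ 6 * B + 3 * X ^ 5 * B ^ 2 + 5 * X ^ 4 * B ^ 3
      + 5 * X ^ 3 * B ^ 4 + 3 * X ^ 2 * B ^ 5 + X * B ^ 6 + of_int t - of_int s * X)"
    unfolding p s B_def by (simp add: algebra_simps)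
  also have "\<dots> \<in> I"
    by (rule ideal_add[OF ideal2_subset[OF F] ideal_mult[OF p_in_ideal]])
  finally have "X + B \<in> I" by (rule prime_power)
  thus ?thesis by (simp add: B_def)
qed

text \<open>\<open>linear_mem\<close> makes \<open>c\<close> the double root, so
  \<open>p ^ 2\<close> divides F(c). By \<open>trinomial_at_double_root\<close> it divides
  \<open>b\<close> times the discriminant, and \<open>b\<close> is prime to
  \<open>p\<close>.\<close>

lemma square_dvd_discriminant:
  assumes p: "p \<notin> {2, 3}" "\<not> p dvd a" "\<not> p dvd b"
  shows "p ^ 2 dvd 7 ^ 7 * b ^ 6 + 6 ^ 6 * a ^ 7"
proof -
  obtain c k where ck: "6 * a * c = - 7 * b + p ^ 2 * k"
    using approximate_double_root prime_p p(1,2) by blast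
  have "of_int (6 * a) * (X - of_int c) = of_int (6 * a) * X + of_int (7 * b) - of_int (6 * a * c + 7 * b)"
    by (simp add: algebra_simps)
  also have "\<dots> \<in> I"
    by (intro ideal_diff linear_mem) (simp only: of_int_mem_iff ck, simp add: power2_eq_square)
  finally have "p dvd 6 * a \<or> X - of_int c \<in> I" by (simp only: of_int_mult_mem_iff)
  hence "X - of_int c \<in> I" using prime_not_dvd_6_mult[OF prime_p p(1,2)] by blast
  hence "p ^ 2 dvd c ^ 7 + a * c + b" by (rule square_dvd_at_root)
  moreover have "p ^ 2 dvd 6 ^ 7 * a ^ 7 * (c ^ 7 + a * c + b) + b * (7 ^ 7 * b ^ 6 + 6 ^ 6 * a ^ 7)"
    using trinomial_at_double_root(1)[OF ck] by (rule dvd_trans[OF dvd_triv_left])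
  ultimately have "p ^ 2 dvd b * (7 ^ 7 * b ^ 6 + 6 ^ 6 * a ^ 7)"
    using dvd_add_right_iff dvd_mult by blast
  moreover have "coprime (p ^ 2) b"
    using prime_p p(3) prime_imp_power_coprime coprime_commute by blast
  ultimately show ?thesis by (simp add: coprime_dvd_mult_right_iff)
qed

end

end

section \<open>Explicit decompositions showing failure of integral closedness\<close>

locale septic_trinomial_field = monogenic_field "X ^ 7 + of_int a * X + of_int b" \<alpha>
  for a b :: int and \<alpha> :: "'a :: field_char_0"
begin

lemma trinomial_pCons: "X ^ 7 + of_int a * X + of_int b = [:b, a, 0, 0, 0, 0, 0, 1:]"
  by (simp add: X_def of_int_poly eval_nat_numeral)

lemma not_integrally_closed_at_root:
  assumes p: "prime p" and d: "p dvd 7 * c ^ 6 + a" and r: "p ^ 2 dvd c ^ 7 + a * c + b"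
  shows "int_adjoin \<alpha> \<noteq> ring_of_integers (rat_adjoin \<alpha>)"
proof -
  obtain s where s: "7 * c ^ 6 + a = p * s" using d by blast
  obtain t where t: "c ^ 7 + a * c + b = p ^ 2 * t" using r by blast
  define f where "f = X - of_int c"
  define g where "g = X ^ 5 + 2 * of_int c * X ^ 4 + 3 * of_int c ^ 2 * X ^ 3 + 4 * of_int c ^ 3 * X ^ 2
      + 5 * of_int c ^ 4 * X + 6 * of_int c ^ 5"
  have f: "f = [:- c, 1:]" by (simp add: f_def X_def of_int_poly)
  have g: "g = [:6 * c ^ 5, 5 * c ^ 4, 4 * c ^ 3, 3 * c ^ 2, 2 * c, 1:]"
    by (simp add: g_def X_def of_int_poly numeral_poly eval_nat_numeral)
  have "X ^ 7 + of_int a * X + of_int b = f ^ 2 * g + of_int (7 * c ^ 6 + a) * f + of_int (c ^ 7 + a * c + b)"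
    unfolding f_def g_def of_int_add of_int_mult of_int_power of_int_numeral by (rule trinomial_taylor)
  also have "\<dots> = f ^ 2 * g + of_int p * f * of_int s + of_int p ^ 2 * of_int t"
    unfolding s t by (simp add: algebra_simps)
  finally have "X ^ 7 + of_int a * X + of_int b =
      f ^ 2 * g + of_int p * f * of_int s + of_int p ^ 2 * of_int t" .
  from not_integrally_closed_if_square_ideal[OF p _ _ _ this] show ?thesis
    unfolding trinomial_pCons f g by simp
qed

text \<open>Here both coefficients of the linear polynomial in \<open>double_root_mod_2\<close> are
  even, so the whole of X^3 + 1 serves as \<open>f\<close>.\<close>

lemma not_integrally_closed_cubic_mod_2:
  assumes a: "a = 4 * s - 1" and b: "b = 4 * t"
  shows "int_adjoin \<alpha> \<noteq> ring_of_integers (rat_adjoin \<alpha>)"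
proof (rule not_integrally_closed_if_square_ideal)
  show "X ^ 7 + of_int a * X + of_int b = (X ^ 3 + 1) ^ 2 * X + of_int 2 * (X ^ 3 + 1) * (- X)
      + of_int 2 ^ 2 * (of_int s * X + of_int t)"
    unfolding a b by (simp add: algebra_simps eval_nat_numeral)
  have f: "X ^ 3 + 1 = [:1, 0, 0, 1:]" by (simp add: X_def eval_nat_numeral one_pCons)
  show "lead_coeff (X ^ 3 + 1) = 1" "lead_coeff X = 1"
    "degree ((X ^ 3 + 1) * X) < degree (X ^ 7 + of_int a * X + of_int b)"
    unfolding trinomial_pCons f by (simp_all add: X_def)
qed simp

text \<open>The hypotheses say that \<open>a\<close> is odd and 4 divides F(-1) = b - a - 1; the
  factor X + 1 serves as \<open>f\<close>.\<close>

lemma not_integrally_closed_linear_mod_2: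
  assumes a: "a = 2 * s - 1" and b: "b = 2 * s + 4 * t"
  shows "int_adjoin \<alpha> \<noteq> ring_of_integers (rat_adjoin \<alpha>)"
proof (rule not_integrally_closed_if_square_ideal)
  show "X ^ 7 + of_int a * X + of_int b = (X + 1) ^ 2 * (X * (X ^ 2 - X + 1) ^ 2)
      + of_int 2 * (X + 1) * (of_int s - X * (X ^ 2 - X + 1)) + of_int 2 ^ 2 * of_int t"
    unfolding a b by (simp add: algebra_simps eval_nat_numeral)
  have "X + 1 = [:1, 1:]" "X * (X ^ 2 - X + 1) ^ 2 = [:0, 1, -2, 3, -2, 1:]"
    by (simp_all add: X_def eval_nat_numeral one_pCons)
  thus "lead_coeff (X + 1) = 1" "lead_coeff (X * (X ^ 2 - X + 1) ^ 2) = 1"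
    "degree ((X + 1) * (X * (X ^ 2 - X + 1) ^ 2)) < degree (X ^ 7 + of_int a * X + of_int b)"
    unfolding trinomial_pCons by (simp_all add: degree_mult_eq)
qed simp

lemma not_integrally_closed_quadratic_mod_3:
  assumes a: "a = 9 * s + 1" and b: "b = 9 * t"
  shows "int_adjoin \<alpha> \<noteq> ring_of_integers (rat_adjoin \<alpha>)"
proof (rule not_integrally_closed_if_square_ideal)
  show "X ^ 7 + of_int a * X + of_int b = (X ^ 2 + 1) ^ 2 * (X ^ 3 + X)
      + of_int 3 * (X ^ 2 + 1) * (- (X ^ 3)) + of_int 3 ^ 2 * (of_int s * X + of_int t)"
    unfolding a b by (simp add: algebra_simps eval_nat_numeral)
  have "X ^ 2 + 1 = [:1, 0, 1:]" "X ^ 3 + X = [:0, 1, 0, 1:]"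
    by (simp_all add: X_def eval_nat_numeral one_pCons)
  thus "lead_coeff (X ^ 2 + 1) = 1" "lead_coeff (X ^ 3 + X) = 1"
    "degree ((X ^ 2 + 1) * (X ^ 3 + X)) < degree (X ^ 7 + of_int a * X + of_int b)"
    unfolding trinomial_pCons by (simp_all add: degree_mult_eq)
qed simp

text \<open>For the approximate double root \<open>c\<close>, \<open>p ^ 2\<close> divides (6a)^7
  F(c) and (6a)^6 F'(c), and \<open>6 * a\<close> is prime to \<open>p\<close>.\<close>

lemma not_integrally_closed_if_square_dvd_discriminant:
  assumes p: "prime p" "p \<notin> {2, 3}" "\<not> p dvd a"
    and D: "p ^ 2 dvd 7 ^ 7 * b ^ 6 + 6 ^ 6 * a ^ 7"
  shows "int_adjoin \<alpha> \<noteq> ring_of_integers (rat_adjoin \<alpha>)"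
proof -
  obtain c k where ck: "6 * a * c = - 7 * b + p ^ 2 * k"
    using approximate_double_root p by blast
  note m = trinomial_at_double_root[OF ck, THEN dvd_trans[OF dvd_triv_left]]
  have cop: "coprime (p ^ i) ((6 * a) ^ j)" for i j
    using prime_imp_coprime[OF p(1) prime_not_dvd_6_mult[OF p]] by (metis coprime_power_left_iff coprime_power_right_iff)
  show ?thesis
  proof (rule not_integrally_closed_at_root[OF p(1)])
    have "p ^ 2 dvd 6 ^ 7 * a ^ 7 * (c ^ 7 + a * c + b)"
      using m(1) D by (simp add: dvd_add_left_iff)
    hence "p ^ 2 dvd (6 * a) ^ 7 * (c ^ 7 + a * c + b)" by (simp only: power_mult_distrib)
    thus "p ^ 2 dvd c ^ 7 + a * c + b"
      using cop[of 2 7] by (simp only: coprime_dvd_mult_right_iff)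
    have "p ^ 2 dvd 6 ^ 6 * a ^ 6 * (7 * c ^ 6 + a)"
      using dvd_add[OF m(2) D] by simp
    hence "p ^ 1 dvd (6 * a) ^ 6 * (7 * c ^ 6 + a)"
      unfolding power_mult_distrib by (rule dvd_trans[rotated]) (simp add: le_imp_power_dvd)
    thus "p dvd 7 * c ^ 6 + a"
      using cop[of 1 6] by (simp only: coprime_dvd_mult_right_iff power_one_right)
  qed
qed

end

section \<open>The equivalence, prime by prime\<close>

theorem theorem2p1:
  fixes a b :: int and F :: "int poly" and \<alpha> :: complex
  assumes F: "F = monom 1 7 + monom a 1 + monom b 0"
    and irred: "irreducible (map_poly rat_of_int F)"
    and val: "\<And>p :: int. prime p \<Longrightarrow> padic_val p a \<le> 5 \<or> padic_val p b \<le> 6"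
    and root: "poly (map_poly of_int F) \<alpha> = 0"
  shows "int_adjoin \<alpha> = ring_of_integers (rat_adjoin \<alpha>) \<longleftrightarrow>
      (\<forall>p :: int. prime p \<longrightarrow> p dvd a \<and> p dvd b \<longrightarrow> padic_val p b = 1)
    \<and> (2 dvd b \<and> \<not> 2 dvd a \<longrightarrow>
         ([a = 3] (mod 4) \<and> [b = 2] (mod 4)) \<or> ([a = 1] (mod 4) \<and> [b = 0] (mod 4)))
    \<and> (3 dvd b \<and> [a = -1] (mod 3) \<longrightarrow>
         padic_val 3 (b + 1 + a) = 1 \<and> padic_val 3 (b - 1 - a) = 1)
    \<and> (3 dvd b \<and> [a = 1] (mod 3) \<longrightarrow>
         [a = 4] (mod 9) \<or> [a = 7] (mod 9) \<or> padic_val 3 b = 1)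
    \<and> (7 dvd a \<and> \<not> 7 dvd b \<longrightarrow> padic_val 7 (1 - a - b ^ 6) = 1)
    \<and> (\<forall>p :: int. prime p \<longrightarrow> p \<notin> {2, 3, 7} \<longrightarrow> \<not> (p dvd a \<and> p dvd b) \<longrightarrow>
         padic_val p (7 ^ 7 * b ^ 6 + 6 ^ 6 * a ^ 7) \<le> 1)"
    (is "?closed \<longleftrightarrow> ?C1 \<and> ?C2 \<and> ?C3 \<and> ?C4 \<and> ?C5 \<and> ?C6")
proof -
  have F': "F = X ^ 7 + of_int a * X + of_int b" unfolding F by (rule trinomial_eq)
  have "F = [:b, a, 0, 0, 0, 0, 0, 1:]" by (simp add: F' X_def of_int_poly eval_nat_numeral)
  hence "lead_coeff F = 1" by simp
  then interpret septic_trinomial_field a b \<alpha>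
    using irred root unfolding septic_trinomial_field_def monogenic_field_def F' by blast
  have prime_3: "prime (3 :: int)" and prime_7: "prime (7 :: int)" by simp_all
  have fermat: "7 dvd 1 - a - b ^ 6" if "7 dvd a" "\<not> 7 dvd b"
  proof -
    have "7 dvd b * (b ^ 6 - 1)"
      using seven_dvd_power_diff[of b] by (simp add: algebra_simps eval_nat_numeral)
    hence "7 dvd b ^ 6 - 1" using that(2) prime_dvd_mult_iff[OF prime_7] by blast
    hence "7 dvd - (b ^ 6 - 1) - a" using that(1) by (intro dvd_diff) (simp_all only: dvd_minus_iff)
    thus ?thesis by (simp add: algebra_simps)
  qed
  show ?thesis
  proof
    assume closed: ?closed
    have C1: ?C1
    proof (intro allI impI, elim conjE)
      fix p :: int assume p: "prime p" "p dvd a" "p dvd b"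
      \<comment> \<open>The double root is 0, where F' and F take the values \<open>a\<close> and
        \<open>b\<close>.\<close>
      have "\<not> p ^ 2 dvd b"
        using not_integrally_closed_at_root[of p 0] p(1,2) closed by auto
      thus "padic_val p b = 1" using p by (simp add: padic_val_eq_1_iff)
    qed
    have C2: ?C2
    proof (rule impI, elim conjE)
      assume ab: "2 dvd b" "\<not> 2 dvd a"
      have "\<not> (a mod 4 = 3 \<and> b mod 4 = 0)"
      proof
        assume "a mod 4 = 3 \<and> b mod 4 = 0"
        hence "a = 4 * (a div 4 + 1) - 1" "b = 4 * (b div 4)" by presburger+
        thus False using not_integrally_closed_cubic_mod_2 closed by blast
      qed
      moreover have "\<not> (a mod 4 = 1 \<and> b mod 4 = 2)"
      proof
        assume *: "a mod 4 = 1 \<and> b mod 4 = 2"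
        hence "a = 2 * ((a + 1) div 2) - 1" "b = 2 * ((a + 1) div 2) + 4 * ((b - a - 1) div 4)"
          by presburger+
        thus False using not_integrally_closed_linear_mod_2 closed by blast
      qed
      ultimately have "(a mod 4 = 3 \<and> b mod 4 = 2) \<or> (a mod 4 = 1 \<and> b mod 4 = 0)"
        using ab by presburger
      thus "([a = 3] (mod 4) \<and> [b = 2] (mod 4)) \<or> ([a = 1] (mod 4) \<and> [b = 0] (mod 4))"
        by (simp add: cong_def)
    qed
    have C3: ?C3
    proof (rule impI, elim conjE)
      assume b: "3 dvd b" and a: "[a = -1] (mod 3)"
      have a1: "3 dvd a + 1" using a by (simp add: cong_iff_dvd_diff)
      hence d: "3 dvd 7 + a" by presburger
      \<comment> \<open>F' is \<open>7 + a\<close> at both 1 and -1, while F is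
        \<open>b + 1 + a\<close> and \<open>b - 1 - a\<close> there.\<close>
      have "\<not> 3 ^ 2 dvd b + 1 + a"
        using not_integrally_closed_at_root[OF prime_3, of 1] d closed by (auto simp: algebra_simps)
      moreover have "\<not> 3 ^ 2 dvd b - 1 - a"
        using not_integrally_closed_at_root[OF prime_3, of "-1"] d closed by (auto simp: algebra_simps)
      moreover have "3 dvd b + 1 + a" "3 dvd b - 1 - a" using a1 b by presburger+
      ultimately show "padic_val 3 (b + 1 + a) = 1 \<and> padic_val 3 (b - 1 - a) = 1"
        by (simp only: padic_val_eq_1_iff[OF prime_3] simp_thms)
    qed
    have C4: ?C4
    proof (rule impI, elim conjE)
      assume b: "3 dvd b" and a: "[a = 1] (mod 3)"
      show "[a = 4] (mod 9) \<or> [a = 7] (mod 9) \<or> padic_val 3 b = 1"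
      proof (rule ccontr)
        assume "\<not> ?thesis"
        hence *: "a mod 9 \<noteq> 4" "a mod 9 \<noteq> 7" "\<not> padic_val 3 b = 1" by (simp_all add: cong_def)
        have "a mod 3 = 1" using a by (simp add: cong_def)
        hence "a = 9 * (a div 9) + 1" using *(1,2) by presburger
        moreover have "9 dvd b" using *(3) b unfolding padic_val_eq_1_iff[OF prime_3] by simp
        hence "b = 9 * (b div 9)" by simp
        ultimately show False using not_integrally_closed_quadratic_mod_3 closed by blast
      qed
    qed
    have C5: ?C5
    proof (rule impI, elim conjE)
      assume ab: "7 dvd a" "\<not> 7 dvd b"
      \<comment> \<open>The value of F at its multiple root \<open>- b\<close> modulo 7.\<close>
      have eq: "(- b) ^ 7 + a * (- b) + b = b * (1 - a - b ^ 6)"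
        by (simp add: algebra_simps eval_nat_numeral)
      have "\<not> 7 ^ 2 dvd b * (1 - a - b ^ 6)"
        using not_integrally_closed_at_root[OF prime_7, of "- b"] ab(1) closed unfolding eq by auto
      hence "\<not> 7 ^ 2 dvd 1 - a - b ^ 6" by (blast intro: dvd_mult)
      thus "padic_val 7 (1 - a - b ^ 6) = 1"
        using fermat[OF ab] by (simp only: padic_val_eq_1_iff[OF prime_7] simp_thms)
    qed
    have C6: ?C6
    proof (intro allI impI)
      fix p :: int assume p: "prime p" "p \<notin> {2, 3, 7}" "\<not> (p dvd a \<and> p dvd b)"
      have "\<not> p ^ 2 dvd 7 ^ 7 * b ^ 6 + 6 ^ 6 * a ^ 7"
      proof
        assume D: "p ^ 2 dvd 7 ^ 7 * b ^ 6 + 6 ^ 6 * a ^ 7"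
        have "\<not> p dvd a"
        proof
          assume a: "p dvd a"
          hence "p dvd 6 ^ 6 * a ^ 7" by (intro dvd_mult dvd_trans[OF _ dvd_power]) auto
          moreover have "p dvd 7 ^ 7 * b ^ 6 + 6 ^ 6 * a ^ 7"
            using D by (metis dvd_mult_left power2_eq_square)
          ultimately have "p dvd 7 ^ 7 * b ^ 6" by (simp only: dvd_add_left_iff)
          hence "p dvd 7 \<or> p dvd b" using p(1) prime_dvd_mult_iff prime_dvd_power by blast
          moreover have "\<not> p dvd 7" using p(1,2) primes_dvd_imp_eq[OF p(1) prime_7] by blast
          ultimately show False using a p(3) by blast
        qed
        thus False
          using not_integrally_closed_if_square_dvd_discriminant[OF p(1) _ _ D] p(2) closed by blast
      qed
      thus "padic_val p (7 ^ 7 * b ^ 6 + 6 ^ 6 * a ^ 7) \<le> 1"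
        by (simp only: padic_val_le_1_iff[OF p(1)] simp_thms)
    qed
    show "?C1 \<and> ?C2 \<and> ?C3 \<and> ?C4 \<and> ?C5 \<and> ?C6" by (intro conjI C1 C2 C3 C4 C5 C6)
  next
    assume "?C1 \<and> ?C2 \<and> ?C3 \<and> ?C4 \<and> ?C5 \<and> ?C6"
    hence C1: ?C1 and C2: ?C2 and C3: ?C3 and C4: ?C4 and C5: ?C5 and C6: ?C6 by blast+
    show ?closed
    proof (rule ccontr)
      assume "\<not> ?closed"
      then obtain p f I g u v where "poly_prime_ideal p f I" and
        decomp: "X ^ 7 + of_int a * X + of_int b = f ^ 2 * g + of_int p * f * u + of_int p ^ 2 * v"
        using square_ideal_if_not_integrally_closed by metis
      then interpret J: poly_prime_ideal p f I by simp
      have sq: "X ^ 7 + of_int a * X + of_int b \<in> J.I2"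
        using decomp unfolding J.I2_def by blast
      note p = J.prime_p
      have ab: "\<not> (p dvd a \<and> p dvd b)"
        using J.square_dvd_if_common_divisor[OF sq] C1 p padic_val_eq_1_iff by blast
      \<comment> \<open>For these primes the relation \<open>6 a X + 7 b\<close> in \<open>I\<close>
        loses its linear term.\<close>
      have pb: "p dvd b" if "p = 2 \<or> p = 3"
      proof -
        have "p dvd 6 * a" using that by auto
        hence "of_int (6 * a) * X \<in> I" unfolding J.of_int_mult_mem_iff ..
        from J.ideal_diff[OF J.linear_mem[OF sq] this] have "of_int (7 * b) \<in> I" by simp
        hence "p dvd 7 * b" by (simp only: J.of_int_mem_iff)
        thus ?thesis using that by (elim disjE; presburger)
      qed
      consider "p = 2" | "p = 3" | "p = 7" | "p \<notin> {2, 3, 7}" by blast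
      thus False
      proof cases
        case 1
        have b: "2 dvd b" and a: "\<not> 2 dvd a" using pb ab 1 by auto
        define s where "s = (a + 1) div 2"
        define t where "t = b div 2"
        have a_eq: "a = 2 * s - 1" using a unfolding s_def by presburger
        have b_eq: "b = 2 * t" using b unfolding t_def by simp
        have lin: "of_int s * X + of_int t \<in> I" by (rule J.double_root_mod_2[OF sq 1 a_eq b_eq])
        \<comment> \<open>Condition (2) makes exactly one of \<open>s\<close> and \<open>t\<close>
          even, so \<open>lin\<close> would put 1 or X into \<open>I\<close>.\<close>
        have "(a mod 4 = 3 \<and> b mod 4 = 2) \<or> (a mod 4 = 1 \<and> b mod 4 = 0)"
          using C2 a b by (simp add: cong_def)
        hence "(p dvd s \<and> \<not> p dvd t) \<or> (\<not> p dvd s \<and> p dvd t)"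
          unfolding a_eq b_eq 1 by presburger
        thus False
        proof (elim disjE conjE)
          assume st: "p dvd s" "\<not> p dvd t"
          hence "of_int s * X \<in> I" unfolding J.of_int_mult_mem_iff by simp
          from J.ideal_diff[OF lin this] show False using st(2) J.of_int_mem_iff by simp
        next
          assume st: "\<not> p dvd s" "p dvd t"
          hence "of_int t \<in> I" by (simp only: J.of_int_mem_iff)
          from J.ideal_diff[OF lin this] have "of_int s * X \<in> I" by simp
          hence "X \<in> I" using st(1) by (simp only: J.of_int_mult_mem_iff simp_thms)
          thus False using J.X_notin[OF sq] a 1 by simp
        qed
      next
        case 2
        have b: "3 dvd b" and a: "\<not> 3 dvd a" using pb ab 2 by auto
        have b_eq: "b = 3 * (b div 3)" using b by simp
        have "a mod 3 = 1 \<or> a mod 3 = 2" using a by presburger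
        thus False
        proof
          assume a1: "a mod 3 = 1"
          have a_eq: "a = 3 * (a div 3) + 1" using a1 by presburger
          from J.quadratic_factor_mod_3[OF sq 2 a_eq b_eq]
          have st: "3 dvd a div 3" "3 dvd b div 3" by auto
          have "a mod 9 = 1" using a1 st(1) by presburger
          moreover have "3 ^ 2 dvd b" using b st(2) by (simp, presburger)
          moreover have "[a = 1] (mod 3)" using a1 by (simp add: cong_def)
          ultimately show False using C4 b unfolding padic_val_eq_1_iff[OF prime_3] cong_def by auto
        next
          assume a2: "a mod 3 = 2"
          have a_eq: "a = 3 * ((a + 1) div 3) - 1" using a2 by presburger
          have "3 dvd a + 1" using a2 by presburger
          hence "[a = -1] (mod 3)" by (simp add: cong_iff_dvd_diff)
          hence n: "\<not> 3 ^ 2 dvd b + 1 + a" "\<not> 3 ^ 2 dvd b - 1 - a"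
            using C3 b unfolding padic_val_eq_1_iff[OF prime_3] by blast+
          from J.double_roots_mod_3[OF sq 2 a_eq b_eq] show False
          proof
            assume "X - of_int 1 \<in> I"
            from J.square_dvd_at_root[OF sq this] show False using n(1) 2 by (simp add: algebra_simps)
          next
            assume "X - of_int (-1) \<in> I"
            from J.square_dvd_at_root[OF sq this] show False using n(2) 2 by (simp add: algebra_simps)
          qed
        qed
      next
        case 3
        \<comment> \<open>Modulo 7 the linear relation reduces to \<open>6 a X\<close>, and X is not
          in \<open>I\<close> when 7 does not divide \<open>a\<close>.\<close>
        have a: "7 dvd a"
        proof (rule ccontr)
          assume na: "\<not> 7 dvd a"
          have "of_int (7 * b) \<in> I" using 3 J.of_int_mem_iff[of "7 * b"] by simp
          from J.ideal_diff[OF J.linear_mem[OF sq] this] have "of_int (6 * a) * X \<in> I" by simp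
          hence "p dvd 6 * a \<or> X \<in> I" by (simp only: J.of_int_mult_mem_iff)
          moreover have "\<not> p dvd 6 * a" using na 3 by presburger
          ultimately show False using J.X_notin[OF sq] na 3 by blast
        qed
        hence b: "\<not> 7 dvd b" using ab 3 by blast
        from J.square_dvd_at_root[OF sq J.multiple_root_mod_7[OF sq 3 a]]
        have "7 ^ 2 dvd (- b) ^ 7 + a * (- b) + b" unfolding 3 .
        also have "(- b) ^ 7 + a * (- b) + b = b * (1 - a - b ^ 6)"
          by (simp add: algebra_simps eval_nat_numeral)
        finally have "7 ^ 2 dvd b * (1 - a - b ^ 6)" .
        moreover have "coprime (7 ^ 2) b"
          using prime_imp_power_coprime[OF prime_7 b] coprime_commute by blast
        ultimately have "7 ^ 2 dvd 1 - a - b ^ 6" by (simp only: coprime_dvd_mult_right_iff)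
        thus False using C5 a b padic_val_eq_1_iff[OF prime_7] by blast
      next
        case 4
        \<comment> \<open>The linear relation shows that if \<open>p\<close> divided one of
          \<open>a\<close>, \<open>b\<close>, it would divide the other or X would lie in
          \<open>I\<close>.\<close>
        have a: "\<not> p dvd a"
        proof
          assume a: "p dvd a"
          hence "of_int (6 * a) * X \<in> I" by (simp only: J.of_int_mult_mem_iff) simp
          from J.ideal_diff[OF J.linear_mem[OF sq] this] have "of_int (7 * b) \<in> I" by simp
          hence "p dvd 7 * b" by (simp only: J.of_int_mem_iff)
          moreover have "\<not> p dvd 7" using 4 primes_dvd_imp_eq[OF p prime_7] by blast
          ultimately show False using a ab p prime_dvd_mult_iff by blast
        qed
        moreover have "\<not> p dvd b"
        proof
          assume "p dvd b"
          hence "of_int (7 * b) \<in> I" by (simp only: J.of_int_mem_iff) simp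
          from J.ideal_diff[OF J.linear_mem[OF sq] this] have "of_int (6 * a) * X \<in> I" by simp
          hence "p dvd 6 * a \<or> X \<in> I" by (simp only: J.of_int_mult_mem_iff)
          moreover have "p \<notin> {2, 3}" using 4 by blast
          ultimately show False using J.X_notin[OF sq a] prime_not_dvd_6_mult[OF p _ a] by blast
        qed
        moreover have "p \<notin> {2, 3}" using 4 by blast
        ultimately have "p ^ 2 dvd 7 ^ 7 * b ^ 6 + 6 ^ 6 * a ^ 7"
          using J.square_dvd_discriminant[OF sq] by blast
        thus False using C6 p 4 ab padic_val_le_1_iff[OF p] by blast
      qed
    qed
  qed
qed

end
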